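(* For all $k\in\mathbb{R}$ and all integers $n\geq 2$, there exist a sequence $(\mathfrak{I}_m)_{m\geq0}$ of spectrahedral shadows and a sequence $(\mathfrak{O}_m)_{m\geq 0}$ of spectrahedra in $\mathrm{Sym}^2_b(\wedge^2\mathbb{R}^n)$, all of them $\mathsf{O}(n)$-invariant, such that $$\mathfrak{I}_0\subset\mathfrak{I}_1\subset\dots\subset\mathfrak{I}_m\subset\dots\subset\mathfrak{R}_{\sec\geq k}(n)\subset\dots\subset\mathfrak{O}_m\subset\dots\subset\mathfrak{O}_1\subset\mathfrak{O}_0,$$ and $$\overline{\bigcup_{m\geq0}\mathfrak{I}_m}=\mathfrak{R}_{\sec\geq k}(n)=\bigcap_{m\geq0}\mathfrak{O}_m .$$
   Context: Equip $\mathbb{R}^n$ with its standard inner product and $\wedge^2\mathbb{R}^n$ with the induced inner product $\langle\cdot,\cdot\rangle$ (so that $e_i\wedge e_j$, $i<j$, is an orthonormal basis). $\mathrm{Sym}^2(\wedge^2\mathbb{R}^n)$ is the space of symmetric endomorphisms of $\wedge^2\mathbb{R}^n$, and $\mathrm{Sym}^2_b(\wedge^2\mathbb{R}^n)$ is the subspace of those $R$ satisfying the first Bianchi identity $\langle R(X\wedge Y),Z\wedge W\rangle+\langle R(Y\wedge Z),X\wedge W\rangle+\langle R(Z\wedge X),Y\wedge W\rangle=0$ for all $X,Y,Z,W\in\mathbb{R}^n$. The sectional curvature of $R$ is the function $\sec_R(\sigma)=\langle R(\sigma),\sigma\rangle$ on $\mathrm{Gr}_2^+(\mathbb{R}^n)=\{X\wedge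 Y\in\wedge^2\mathbb{R}^n:\|X\wedge Y\|=1\}$, and $\mathfrak{R}_{\sec\geq k}(n)=\{R\in\mathrm{Sym}^2_b(\wedge^2\mathbb{R}^n):\sec_R\geq k\}$. The orthogonal group $\mathsf{O}(n)$ acts on $\mathrm{Sym}^2_b(\wedge^2\mathbb{R}^n)$ by $g\cdot R=(\wedge^2 g)\,R\,(\wedge^2 g)^{-1}$. A spectrahedron is a subset of $\mathbb{R}^N$ of the form $\{x\in\mathbb{R}^N: A+\sum_{i=1}^N x_iB_i\succeq 0\}$, where $A,B_i$ are real symmetric $d\times d$ matrices for some $d$ and $\succeq 0$ means positive-semidefinite. A spectrahedral shadow is the image of a spectrahedron under a linear projection, i.e., a set of the form $\{x\in\mathbb{R}^N:\exists\,y\in\mathbb{R}^m,\ A+\sum_i x_iB_i+\sum_j y_jC_j\succeq0\}$ with $A,B_i,C_j$ real symmetric matrices. These notions apply to subsets of any finite-dimensional real vector space by choosing a linear isomorphism with $\mathbb{R}^N$. *)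

theory Defs
  imports "HOL-Analysis.Analysis"
begin

section \<open>The exterior square of Euclidean space\<close>

text \<open>
  The exterior square of \<open>real ^ 'n\<close> is realised as the space of skew-symmetric matrices, with
  \<open>X \<and> Y\<close> corresponding to \<open>X Y\<^sup>T - Y X\<^sup>T\<close>. The inner product is half the Frobenius inner product,
  which makes the bivectors \<open>e\<^sub>i \<and> e\<^sub>j\<close> of distinct (unordered) pairs orthonormal.
\<close>

typedef ('n::finite) bivector = "{A :: real^'n^'n. transpose A = - A}"
  morphisms mat_of_bivector bivector_of_mat
  by (rule exI[of _ 0]) (simp add: transpose_def vec_eq_iff)

setup_lifting type_definition_bivector

lemma bivector_skew: "mat_of_bivector w $ i $ j = - (mat_of_bivector w $ j $ i)"
proof -
  have "transpose (mat_of_bivector w) $ i $ j = (- mat_of_bivector w) $ i $ j"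
    using mat_of_bivector[of w] by simp
  then show ?thesis by (simp add: transpose_def)
qed

lemma transpose_simps:
  fixes A B :: "real^'n^'m"
  shows "transpose 0 = (0 :: real^'n^'m)" "transpose (A + B) = transpose A + transpose B"
    "transpose (A - B) = transpose A - transpose B" "transpose (- A) = - transpose A"
    "transpose (c *\<^sub>R A) = c *\<^sub>R transpose A"
  by (simp_all add: transpose_def vec_eq_iff)

instantiation bivector :: (finite) real_inner
begin

lift_definition zero_bivector :: "'a bivector" is 0
  by (simp add: transpose_simps)
lift_definition plus_bivector :: "'a bivector \<Rightarrow> 'a bivector \<Rightarrow> 'a bivector" is "(+)"
  by (simp add: transpose_simps)
lift_definition minus_bivector :: "'a bivector \<Rightarrow> 'a bivector \<Rightarrow> 'a bivector" is "(-)"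
  by (simp add: transpose_simps)
lift_definition uminus_bivector :: "'a bivector \<Rightarrow> 'a bivector" is uminus
  by (simp add: transpose_simps)
lift_definition scaleR_bivector :: "real \<Rightarrow> 'a bivector \<Rightarrow> 'a bivector" is "(*\<^sub>R)"
  by (simp add: transpose_simps)
lift_definition inner_bivector :: "'a bivector \<Rightarrow> 'a bivector \<Rightarrow> real" is "\<lambda>A B. (A \<bullet> B) / 2" .

definition norm_bivector :: "'a bivector \<Rightarrow> real"
  where "norm_bivector v = sqrt (v \<bullet> v)"
definition dist_bivector :: "'a bivector \<Rightarrow> 'a bivector \<Rightarrow> real"
  where "dist_bivector v w = norm (v - w)"
definition sgn_bivector :: "'a bivector \<Rightarrow> 'a bivector"
  where "sgn_bivector v = inverse (norm v) *\<^sub>R v"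
definition uniformity_bivector :: "('a bivector \<times> 'a bivector) filter"
  where "uniformity_bivector = (INF e\<in>{0 <..}. principal {(v, w). dist v w < e})"
definition open_bivector :: "'a bivector set \<Rightarrow> bool"
  where "open_bivector U \<longleftrightarrow> (\<forall>v\<in>U. \<forall>\<^sub>F (v', w) in uniformity. v' = v \<longrightarrow> w \<in> U)"

instance
proof
  fix u v w :: "'a bivector" and a b :: real and U :: "'a bivector set"
  show "u + v + w = u + (v + w)" by transfer simp
  show "u + v = v + u" by transfer simp
  show "0 + v = v" by transfer simp
  show "- v + v = 0" by transfer simp
  show "u - v = u + - v" by transfer simp
  show "a *\<^sub>R (u + v) = a *\<^sub>R u + a *\<^sub>R v" by transfer (simp add: scaleR_right_distrib)
  show "(a + b) *\<^sub>R v = a *\<^sub>R v + b *\<^sub>R v" by transfer (simp add: scaleR_left_distrib)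
  show "a *\<^sub>R b *\<^sub>R v = (a * b) *\<^sub>R v" by transfer simp
  show "1 *\<^sub>R v = v" by transfer simp
  show "u \<bullet> v = v \<bullet> u" by transfer (simp add: inner_commute)
  show "(u + v) \<bullet> w = u \<bullet> w + v \<bullet> w" by transfer (simp add: inner_add_left add_divide_distrib)
  show "(a *\<^sub>R u) \<bullet> v = a * (u \<bullet> v)" by transfer simp
  show "0 \<le> u \<bullet> u" by transfer simp
  show "u \<bullet> u = 0 \<longleftrightarrow> u = 0" by transfer simp
qed (simp_all only: norm_bivector_def dist_bivector_def sgn_bivector_def
    uniformity_bivector_def open_bivector_def)

end

lift_definition wedge :: "real^'n \<Rightarrow> real^'n \<Rightarrow> ('n::finite) bivector" (infixr "\<and>\<^sub>b" 72)
  is "\<lambda>X Y. (\<chi> i j. X $ i * Y $ j - X $ j * Y $ i)"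
  by (simp add: transpose_def vec_eq_iff)

lemma wedge_add_left: "(X + X') \<and>\<^sub>b Y = X \<and>\<^sub>b Y + X' \<and>\<^sub>b Y"
  by transfer (simp add: vec_eq_iff algebra_simps)

lemma wedge_scaleR_left: "(c *\<^sub>R X) \<and>\<^sub>b Y = c *\<^sub>R (X \<and>\<^sub>b Y)"
  by transfer (simp add: vec_eq_iff algebra_simps)

lemma wedge_swap: "Y \<and>\<^sub>b X = - (X \<and>\<^sub>b Y)"
  by transfer (simp add: vec_eq_iff algebra_simps)

lemma wedge_self: "X \<and>\<^sub>b X = 0"
  by transfer (simp add: vec_eq_iff)

lemma inner_wedge:
  "(X \<and>\<^sub>b Y) \<bullet> (Z \<and>\<^sub>b W) = (X \<bullet> Z) * (Y \<bullet> W) - (X \<bullet> W) * (Y \<bullet> Z)"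
proof transfer
  fix X Y Z W :: "real^'n"
  let ?S = "\<lambda>f. \<Sum>i\<in>UNIV. \<Sum>j\<in>UNIV. f i j"
  have *: "(A \<bullet> B) * (C \<bullet> D) = ?S (\<lambda>i j. A $ i * B $ i * (C $ j * D $ j))"
    for A B C D :: "real^'n"
    by (simp add: inner_vec_def sum_product)
  have "(\<chi> i j. X $ i * Y $ j - X $ j * Y $ i) \<bullet> (\<chi> i j. Z $ i * W $ j - Z $ j * W $ i)
      = ?S (\<lambda>i j. (X $ i * Y $ j - X $ j * Y $ i) * (Z $ i * W $ j - Z $ j * W $ i))"
    by (simp add: inner_vec_def)
  also have "\<dots> = ?S (\<lambda>i j. X $ i * Z $ i * (Y $ j * W $ j))
      - ?S (\<lambda>i j. X $ i * W $ i * (Y $ j * Z $ j))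
      - ?S (\<lambda>i j. Y $ i * Z $ i * (X $ j * W $ j))
      + ?S (\<lambda>i j. Y $ i * W $ i * (X $ j * Z $ j))"
    unfolding sum_subtractf[symmetric] sum.distrib[symmetric]
    by (intro sum.cong refl) (simp add: algebra_simps)
  also have "\<dots> = 2 * ((X \<bullet> Z) * (Y \<bullet> W) - (X \<bullet> W) * (Y \<bullet> Z))"
    unfolding *[symmetric] by (simp add: algebra_simps)
  finally show "(\<chi> i j. X $ i * Y $ j - X $ j * Y $ i)
      \<bullet> (\<chi> i j. Z $ i * W $ j - Z $ j * W $ i) / 2
    = (X \<bullet> Z) * (Y \<bullet> W) - (X \<bullet> W) * (Y \<bullet> Z)"
    by simp
qed

lemma wedge_axis_orthonormal:
  assumes "i \<noteq> j" "k \<noteq> l"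
  shows "(axis i 1 \<and>\<^sub>b axis j 1) \<bullet> (axis k 1 \<and>\<^sub>b axis l 1)
    = (if i = k \<and> j = l then 1 else if i = l \<and> j = k then - 1 else 0)"
  using assms by (auto simp: inner_wedge inner_axis_axis)

lemma mat_of_bivector_add: "mat_of_bivector (v + w) = mat_of_bivector v + mat_of_bivector w"
  by transfer simp

lemma mat_of_bivector_scaleR: "mat_of_bivector (c *\<^sub>R v) = c *\<^sub>R mat_of_bivector v"
  by transfer simp

lemma mat_of_bivector_0: "mat_of_bivector 0 = 0"
  by transfer simp

lemma mat_of_bivector_sum: "mat_of_bivector (sum f A) = (\<Sum>a\<in>A. mat_of_bivector (f a))"
  by (induction A rule: infinite_finite_induct)
     (simp_all add: mat_of_bivector_add mat_of_bivector_0)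

lemma bivector_expansion:
  "w = (\<Sum>i\<in>UNIV. \<Sum>j\<in>UNIV. (mat_of_bivector w $ i $ j / 2) *\<^sub>R (axis i 1 \<and>\<^sub>b axis j 1))"
proof (subst mat_of_bivector_inject[symmetric], subst vec_eq_iff, subst vec_eq_iff, intro allI)
  fix a b
  let ?m = "mat_of_bivector w"
  have "mat_of_bivector (\<Sum>i\<in>UNIV. \<Sum>j\<in>UNIV. (?m $ i $ j / 2) *\<^sub>R (axis i 1 \<and>\<^sub>b axis j 1)) $ a $ b
    = (\<Sum>i\<in>UNIV. \<Sum>j\<in>UNIV. ?m $ i $ j / 2 *
        ((if a = i then 1 else 0) * (if b = j then 1 else 0)
          - (if b = i then 1 else 0) * (if a = j then 1 else 0)))"
    by (simp add: mat_of_bivector_sum mat_of_bivector_scaleR wedge.rep_eq axis_def)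
  also have "\<dots> = (\<Sum>i\<in>UNIV. \<Sum>j\<in>UNIV. if a = i then if b = j then ?m $ i $ j / 2 else 0 else 0)
      - (\<Sum>i\<in>UNIV. \<Sum>j\<in>UNIV. if b = i then if a = j then ?m $ i $ j / 2 else 0 else 0)"
    unfolding sum_subtractf[symmetric] by (intro sum.cong refl) (simp add: algebra_simps)
  also have "\<dots> = ?m $ a $ b / 2 - ?m $ b $ a / 2"
  proof -
    have 1: "(\<Sum>i\<in>UNIV. \<Sum>j\<in>UNIV. if p = i then if q = j then ?m $ i $ j / 2 else 0 else 0)
        = (\<Sum>i\<in>UNIV. if p = i then ?m $ i $ q / 2 else 0)" for p q
      by (intro sum.cong refl) auto
    show ?thesis unfolding 1 by simp
  qed
  also have "\<dots> = ?m $ a $ b"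
    using bivector_skew[of w b a] by simp
  finally show "?m $ a $ b = mat_of_bivector (\<Sum>i\<in>UNIV. \<Sum>j\<in>UNIV.
      (?m $ i $ j / 2) *\<^sub>R (axis i 1 \<and>\<^sub>b axis j 1)) $ a $ b" ..
qed

lemma span_wedge: "span (range (\<lambda>(X, Y). X \<and>\<^sub>b Y)) = (UNIV :: 'n::finite bivector set)"
proof -
  have "w \<in> span (range (\<lambda>(X, Y). X \<and>\<^sub>b Y))" for w :: "'n bivector"
    by (subst bivector_expansion[of w]) (intro span_sum span_scale span_base, auto)
  then show ?thesis by auto
qed

lemma linear_bivector_bounded:
  fixes f :: "'n::finite bivector \<Rightarrow> 'b::real_normed_vector"
  assumes "linear f"
  shows "bounded_linear f"
proof -
  interpret linear f by fact
  let ?e = "\<lambda>i j. (axis i 1 \<and>\<^sub>b axis j 1 :: 'n bivector)"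
  define C where "C = (\<Sum>i\<in>UNIV. \<Sum>j\<in>UNIV. norm (f (?e i j)))"
  have entry: "\<bar>mat_of_bivector w $ i $ j / 2\<bar> \<le> norm w" for w :: "'n bivector" and i j
  proof -
    have "\<bar>mat_of_bivector w $ i $ j\<bar> \<le> norm (mat_of_bivector w $ i)"
      by (rule component_le_norm_cart)
    also have "\<dots> \<le> norm (mat_of_bivector w)"
      by (rule Finite_Cartesian_Product.norm_nth_le)
    also have "\<dots> \<le> 2 * norm w"
    proof -
      have "norm (mat_of_bivector w) ^ 2 = 2 * (norm w) ^ 2"
        by (simp add: power2_norm_eq_inner inner_bivector.rep_eq)
      also have "\<dots> \<le> (2 * norm w) ^ 2" by (simp add: power_mult_distrib)
      finally show ?thesis by (rule power2_le_imp_le) simp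
    qed
    finally show ?thesis by simp
  qed
  have "norm (f w) \<le> norm w * C" for w
  proof -
    have "f w = (\<Sum>i\<in>UNIV. \<Sum>j\<in>UNIV. (mat_of_bivector w $ i $ j / 2) *\<^sub>R f (?e i j))"
      by (subst bivector_expansion[of w]) (simp only: sum scaleR)
    also have "norm \<dots> \<le> (\<Sum>i\<in>UNIV. \<Sum>j\<in>UNIV. norm w * norm (f (?e i j)))"
      by (intro sum_norm_le) (simp only: norm_scaleR mult_right_mono[OF entry] norm_ge_zero real_norm_def)
    also have "\<dots> = norm w * C" by (simp add: C_def sum_distrib_left)
    finally show ?thesis .
  qed
  then show ?thesis by (intro bounded_linear_intro[where K = C]) (auto simp: add scaleR)
qed

lemma skew_congruence:
  fixes g A :: "real^'n^'n"
  assumes "transpose A = - A"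
  shows "transpose (g ** A ** transpose g) = - (g ** A ** transpose g)"
proof -
  have "transpose (g ** A ** transpose g) = g ** (- A) ** transpose g"
    by (simp add: matrix_transpose_mul assms matrix_mul_assoc)
  also have "\<dots> = - (g ** A ** transpose g)"
    by (simp add: vec_eq_iff matrix_matrix_mult_def sum_negf sum_distrib_right)
  finally show ?thesis .
qed

text \<open>The induced map \<open>\<and>\<^sup>2 g\<close>; on skew-symmetric matrices it is the congruence \<open>A \<mapsto> g A g\<^sup>T\<close>.\<close>

lift_definition wedge2 :: "real^'n^'n \<Rightarrow> ('n::finite) bivector \<Rightarrow> 'n bivector"
  is "\<lambda>g A. g ** A ** transpose g"
  using skew_congruence by auto

lemma wedge2_wedge: "wedge2 g (X \<and>\<^sub>b Y) = (g *v X) \<and>\<^sub>b (g *v Y)"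
proof transfer
  fix g :: "real^'n^'n" and X Y :: "real^'n"
  show "g ** (\<chi> i j. X $ i * Y $ j - X $ j * Y $ i) ** transpose g
    = (\<chi> i j. (g *v X) $ i * (g *v Y) $ j - (g *v X) $ j * (g *v Y) $ i)"
    unfolding vec_eq_iff
  proof (intro allI)
    fix i j
    have 1: "(g *v X) $ i * (g *v Y) $ j = (\<Sum>l\<in>UNIV. \<Sum>k\<in>UNIV. g $ i $ k * X $ k * (g $ j $ l * Y $ l))"
      by (subst sum.swap) (simp add: matrix_vector_mult_def sum_product)
    have 2: "(g *v X) $ j * (g *v Y) $ i = (\<Sum>l\<in>UNIV. \<Sum>k\<in>UNIV. g $ j $ l * X $ l * (g $ i $ k * Y $ k))"
      by (simp add: matrix_vector_mult_def sum_product)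
    show "(g ** (\<chi> i j. X $ i * Y $ j - X $ j * Y $ i) ** transpose g) $ i $ j
      = (\<chi> i j. (g *v X) $ i * (g *v Y) $ j - (g *v X) $ j * (g *v Y) $ i) $ i $ j"
      apply (simp only: 1 2 vec_lambda_beta)
      apply (simp add: matrix_matrix_mult_def transpose_def sum_distrib_right sum_subtractf[symmetric])
      apply (intro sum.cong refl)
      apply (simp add: algebra_simps)
      done
  qed
qed

lemma linear_wedge2: "linear (wedge2 (g :: real^'a^'a))"
proof
  fix v w :: "'a bivector" and c :: real
  show "wedge2 g (v + w) = wedge2 g v + wedge2 g w"
    by transfer (simp add: matrix_add_ldistrib vec_eq_iff matrix_matrix_mult_def
        sum_distrib_right sum.distrib algebra_simps)
  show "wedge2 g (c *\<^sub>R v) = c *\<^sub>R wedge2 g v"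
    by transfer (simp add: vec_eq_iff matrix_matrix_mult_def sum_distrib_right sum_distrib_left
        algebra_simps)
qed

lemma inv_wedge2:
  fixes g :: "real^'n^'n"
  assumes "orthogonal_matrix g"
  shows "inv (wedge2 g) = wedge2 (transpose g)"
proof (rule inv_unique_comp)
  have g: "g ** transpose g = mat 1" "transpose g ** g = mat 1"
    using assms by (auto simp: orthogonal_matrix_def)
  have comp: "wedge2 a (wedge2 b w) = wedge2 (a ** b) w" for a b :: "real^'n^'n" and w
    by transfer (simp add: matrix_transpose_mul matrix_mul_assoc)
  have one: "wedge2 (mat 1) w = w" for w :: "'n bivector"
    by transfer (simp add: transpose_mat)
  show "wedge2 g \<circ> wedge2 (transpose g) = id" "wedge2 (transpose g) \<circ> wedge2 g = id"
    by (auto simp: comp one g fun_eq_iff)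
qed


section \<open>Algebraic curvature operators\<close>

text \<open>
  Endomorphisms of the exterior square are represented by bounded linear functions; by
  \<open>linear_bivector_bounded\<close> every linear endomorphism is of this form.
\<close>

type_synonym 'n bivector_endo = "'n bivector \<Rightarrow>\<^sub>L 'n bivector"

definition Sym2 :: "('n::finite) bivector_endo set"
  where "Sym2 = {R :: 'n bivector_endo. \<forall>v w. R v \<bullet> w = v \<bullet> R w}"

definition Sym2_b :: "('n::finite) bivector_endo set"
  where "Sym2_b = {R :: 'n bivector_endo. R \<in> Sym2 \<and> (\<forall>X Y Z W.
    R (X \<and>\<^sub>b Y) \<bullet> (Z \<and>\<^sub>b W) + R (Y \<and>\<^sub>b Z) \<bullet> (X \<and>\<^sub>b W) + R (Z \<and>\<^sub>b X) \<bullet> (Y \<and>\<^sub>b W) = 0)}"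

definition Gr2 :: "('n::finite) bivector set"
  where "Gr2 = {X \<and>\<^sub>b Y | X Y. norm (X \<and>\<^sub>b Y) = 1}"

definition sec_curv :: "('n::finite) bivector_endo \<Rightarrow> 'n bivector \<Rightarrow> real"
  where "sec_curv R \<sigma> = R \<sigma> \<bullet> \<sigma>"

definition R_sec_ge :: "real \<Rightarrow> ('n::finite) bivector_endo set"
  where "R_sec_ge k = {R \<in> Sym2_b. \<forall>\<sigma>\<in>Gr2. sec_curv R \<sigma> \<ge> k}"

definition orth_act :: "real^'n^'n \<Rightarrow> ('n::finite) bivector_endo \<Rightarrow> 'n bivector_endo"
  where "orth_act g R = Blinfun (wedge2 g \<circ> blinfun_apply R \<circ> inv (wedge2 g))"

lemma blinfun_apply_orth_act:
  assumes "orthogonal_matrix g"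
  shows "blinfun_apply (orth_act g R) = wedge2 g \<circ> blinfun_apply R \<circ> inv (wedge2 g)"
proof -
  have "linear (wedge2 g \<circ> blinfun_apply R \<circ> inv (wedge2 g))"
    unfolding inv_wedge2[OF assms]
    by (intro linear_compose linear_wedge2 bounded_linear.linear blinfun.bounded_linear_right)
  then show ?thesis
    unfolding orth_act_def by (intro bounded_linear_Blinfun_apply linear_bivector_bounded)
qed

definition O_invariant :: "('n::finite) bivector_endo set \<Rightarrow> bool"
  where "O_invariant S \<longleftrightarrow> (\<forall>g. orthogonal_matrix g \<longrightarrow> orth_act g ` S = S)"


section \<open>Spectrahedra and spectrahedral shadows\<close>

text \<open>
  Since the number of variables and the matrix sizes are quantified existentially, vectors in
  \<open>\<real>\<^sup>N\<close> are functions on \<open>nat\<close> vanishing from \<open>N\<close> on, and a \<open>d \<times> d\<close> matrix is a function of two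
  indices of which only the values at indices below \<open>d\<close> matter.
\<close>

definition rspace :: "nat \<Rightarrow> (nat \<Rightarrow> real) set"
  where "rspace N = {x. \<forall>i\<ge>N. x i = 0}"

definition sym_mat :: "nat \<Rightarrow> (nat \<Rightarrow> nat \<Rightarrow> real) \<Rightarrow> bool"
  where "sym_mat d M \<longleftrightarrow> (\<forall>a<d. \<forall>b<d. M a b = M b a)"

definition psd_mat :: "nat \<Rightarrow> (nat \<Rightarrow> nat \<Rightarrow> real) \<Rightarrow> bool"
  where "psd_mat d M \<longleftrightarrow> sym_mat d M \<and> (\<forall>v. (\<Sum>a<d. \<Sum>b<d. v a * M a b * v b) \<ge> 0)"

definition spectrahedron :: "nat \<Rightarrow> (nat \<Rightarrow> real) set \<Rightarrow> bool"
  where "spectrahedron N S \<longleftrightarrow> (\<exists>d A B.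
    sym_mat d A \<and> (\<forall>i<N. sym_mat d (B i)) \<and>
    S = {x \<in> rspace N. psd_mat d (\<lambda>a b. A a b + (\<Sum>i<N. x i * B i a b))})"

definition spectrahedral_shadow :: "nat \<Rightarrow> (nat \<Rightarrow> real) set \<Rightarrow> bool"
  where "spectrahedral_shadow N S \<longleftrightarrow> (\<exists>d m A B C.
    sym_mat d A \<and> (\<forall>i<N. sym_mat d (B i)) \<and> (\<forall>j<m. sym_mat d (C j)) \<and>
    S = {x \<in> rspace N. \<exists>y \<in> rspace m.
          psd_mat d (\<lambda>a b. A a b + (\<Sum>i<N. x i * B i a b) + (\<Sum>j<m. y j * C j a b))})"

definition coord_iso :: "nat \<Rightarrow> ((nat \<Rightarrow> real) \<Rightarrow> 'v) \<Rightarrow> 'v::real_vector set \<Rightarrow> bool"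
  where "coord_iso N \<phi> V \<longleftrightarrow> bij_betw \<phi> (rspace N) V \<and>
    (\<forall>x\<in>rspace N. \<forall>y\<in>rspace N. \<phi> (\<lambda>i. x i + y i) = \<phi> x + \<phi> y) \<and>
    (\<forall>c. \<forall>x\<in>rspace N. \<phi> (\<lambda>i. c * x i) = c *\<^sub>R \<phi> x)"

definition spectrahedron_in :: "'v::real_vector set \<Rightarrow> 'v set \<Rightarrow> bool"
  where "spectrahedron_in V S \<longleftrightarrow>
    (\<exists>N \<phi> T. coord_iso N \<phi> V \<and> spectrahedron N T \<and> S = \<phi> ` T)"

definition spectrahedral_shadow_in :: "'v::real_vector set \<Rightarrow> 'v set \<Rightarrow> bool"
  where "spectrahedral_shadow_in V S \<longleftrightarrow>
    (\<exists>N \<phi> T. coord_iso N \<phi> V \<and> spectrahedral_shadow N T \<and> S = \<phi> ` T)"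

end

theory Submission
  imports Defs
begin

text \<open>
  For \<open>z = (X, Y)\<close> put \<open>F\<^sub>R(z) = \<langle>R(X \<and> Y), X \<and> Y\<rangle> - k \<bar>X \<and> Y\<bar>\<^sup>2\<close>, a polynomial in \<open>z\<close> depending affinely
  on \<open>R\<close>; the condition \<open>sec\<^sub>R \<ge> k\<close> says that \<open>F\<^sub>R \<ge> 0\<close>. The outer sets ask that \<open>\<integral> F\<^sub>R p\<^sup>2 \<ge> 0\<close> over the
  unit ball for all polynomials \<open>p\<close> of degree at most \<open>m\<close>, a linear matrix inequality in \<open>R\<close>; for
  \<open>m \<rightarrow> \<infinity>\<close> polynomials approximating the negative part of \<open>F\<^sub>R\<close> force \<open>F\<^sub>R \<ge> 0\<close>. The inner sets ask that
  \<open>F\<^sub>R\<close> agrees, on a compact set \<open>K\<close> of representatives of all planes, with a sum of squares of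
  polynomials of degree at most \<open>m\<close>. If \<open>F\<^sub>R > 0\<close> on \<open>K\<close>, then \<open>F\<^sub>R\<close> has such a representation for large
  \<open>m\<close>: a modification of \<open>F\<^sub>R\<close> off \<open>K\<close> is positive on a cube, hence has nonnegative Bernstein coefficients,
  and on the unit sphere \<open>(1 \<plusminus> z\<^sub>i) / 2\<close> is a sum of squares. Replacing \<open>R\<close> by \<open>R + \<epsilon> id\<close> gives density.
\<close>

section \<open>Finite linear combinations of functions\<close>

text \<open>The obstacle is strict positivity. F_R vanishes at every degenerate pair (X parallel to
  Y), so it is never positive on a whole sphere of pairs, whatever R is. On K the number |X \<and>
  Y|^2 is the constant 1/4, hence F_R grows by eps/4 there when eps id is added to R, and positivity
  becomes attainable. K is cut out of the unit sphere by one more polynomial equation, and this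
  gives the freedom to change F_R off K. The argument needs positivity and not mere nonnegativity,
  which is why the inner sets are only claimed to be dense. The two kinds of sets differ because the
  outer inequalities are linear in R for each p and involve no further unknown, whereas the inner
  condition contains an unknown Gram matrix that has to be projected away. Moreover an identity on
  the infinite set K must be replaced by finitely many equations. Invariance needs no averaging: g
  acts on pairs by a linear isometry with F_(g.R)(z) = F_R(g^-1 z), and such isometries preserve K,
  the ball, Lebesgue measure and the degree of a polynomial.\<close>

inductive fspan :: "('a \<Rightarrow> real) set \<Rightarrow> ('a \<Rightarrow> real) \<Rightarrow> bool" for Q where
  zero: "fspan Q (\<lambda>_. 0)"
| step: "q \<in> Q \<Longrightarrow> fspan Q F \<Longrightarrow> fspan Q (\<lambda>x. c * q x + F x)"

lemma fspan_base: "q \<in> Q \<Longrightarrow> fspan Q q"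
  using fspan.step[OF _ fspan.zero, of q Q 1] by simp

lemma fspan_add:
  assumes "fspan Q F" "fspan Q G"
  shows "fspan Q (\<lambda>x. F x + G x)"
  using assms
proof (induction rule: fspan.induct)
  case (step q F c)
  then show ?case
    using fspan.step[of q Q "\<lambda>x. F x + G x" c] by (simp add: add.assoc)
qed simp

lemma fspan_scale: "fspan Q F \<Longrightarrow> fspan Q (\<lambda>x. c * F x)"
proof (induction rule: fspan.induct)
  case zero
  then show ?case by (simp add: fspan.zero)
next
  case (step q F c')
  then show ?case
    using fspan.step[of q Q "\<lambda>x. c * F x" "c * c'"] by (simp add: algebra_simps)
qed

lemma fspan_sum:
  assumes "\<And>i. i \<in> I \<Longrightarrow> fspan Q (F i)"
  shows "fspan Q (\<lambda>x. \<Sum>i\<in>I. F i x)"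
  using assms by (induction I rule: infinite_finite_induct) (auto intro: fspan.zero fspan_add)

text \<open>Multiplying by a fixed \<open>u\<close> and substituting a fixed \<open>h\<close> are
  linear in \<open>F\<close>, so checking the generators is enough. It is used with
  \<open>u = 1\<close> for substitutions and with \<open>h\<close> the identity for multiplication
  by a coordinate.\<close>

lemma fspan_compose_mult:
  assumes "fspan Q F" "\<And>q. q \<in> Q \<Longrightarrow> fspan Q' (\<lambda>x. u x * q (h x))"
  shows "fspan Q' (\<lambda>x. u x * F (h x))"
  using assms(1)
proof (induction rule: fspan.induct)
  case zero
  then show ?case by (simp add: fspan.zero)
next
  case (step q F c)
  have "fspan Q' (\<lambda>x. c * (u x * q (h x)) + u x * F (h x))"
    by (intro fspan_add fspan_scale assms(2) step)
  then show ?case by (simp add: algebra_simps)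
qed

lemma fspan_compose:
  assumes "fspan Q F" "\<And>q. q \<in> Q \<Longrightarrow> fspan Q' (\<lambda>x. q (h x))"
  shows "fspan Q' (\<lambda>x. F (h x))"
  using fspan_compose_mult[of Q F Q' "\<lambda>_. 1" h] assms by simp

lemma fspan_mono: "fspan Q F \<Longrightarrow> Q \<subseteq> Q' \<Longrightarrow> fspan Q' F"
  using fspan_compose[of Q F Q' "\<lambda>x. x"] by (auto intro: fspan_base)

lemma fspan_coeffs:
  fixes b :: "nat \<Rightarrow> 'a \<Rightarrow> real"
  assumes "fspan (b ` {..<r}) F"
  shows "\<exists>c. \<forall>x. F x = (\<Sum>a<r. c a * b a x)"
  using assms
proof (induction rule: fspan.induct)
  case zero
  show ?case by (rule exI[of _ "\<lambda>_. 0"]) simp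
next
  case (step q F c)
  then obtain c' i where c': "\<And>x. F x = (\<Sum>a<r. c' a * b a x)" and i: "i < r" "q = b i"
    by blast
  \<comment> \<open>\<open>b\<close> may take the same function several times; \<open>c\<close> is
    charged to the one chosen index \<open>i\<close> of \<open>q\<close>.\<close>
  have "c * q x + F x = (\<Sum>a<r. ((if a = i then c else 0) + c' a) * b a x)" for x
  proof -
    have "(\<Sum>a<r. ((if a = i then c else 0) + c' a) * b a x)
        = (\<Sum>a<r. (if a = i then c * b a x else 0) + c' a * b a x)"
      by (intro sum.cong) (auto simp: algebra_simps)
    then show ?thesis using i c' by (simp add: sum.distrib)
  qed
  then show ?case by (intro exI allI)
qed

lemma fspan_insert:
  assumes "fspan (insert q Q) F"
  shows "\<exists>c G. fspan Q G \<and> (\<forall>x. F x = c * q x + G x)"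
  using assms
proof (induction rule: fspan.induct)
  case zero
  show ?case by (rule exI[of _ 0], rule exI[of _ "\<lambda>_. 0"]) (simp add: fspan.zero)
next
  case (step p F c)
  then obtain d G where dG: "fspan Q G" "\<And>x. F x = d * q x + G x" by blast
  show ?case
  proof (cases "p = q")
    case True
    then show ?thesis
      using dG by (intro exI[of _ "c + d"] exI[of _ G]) (simp add: algebra_simps)
  next
    case False
    then have "fspan Q (\<lambda>x. c * p x + G x)"
      using step.hyps dG by (intro fspan.step) auto
    then show ?thesis
      using dG by (intro exI[of _ d] exI[of _ "\<lambda>x. c * p x + G x"]) simp
  qed
qed

text \<open>Restricted to \<open>K\<close> the combinations form a finite-dimensional space, so
  finitely many evaluations separate its elements. In the induction each generator costs at most one
  new point.\<close>

lemma fspan_finite_sampling: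
  assumes "finite Q"
  shows "\<exists>S. finite S \<and> S \<subseteq> K \<and>
    (\<forall>F. fspan Q F \<longrightarrow> (\<forall>s\<in>S. F s = 0) \<longrightarrow> (\<forall>x\<in>K. F x = 0))"
  using assms
proof (induction Q)
  case empty
  have "F = (\<lambda>_. 0)" if "fspan {} F" for F :: "'a \<Rightarrow> real"
    using that by (cases rule: fspan.cases) auto
  then show ?case by (intro exI[of _ "{}"]) auto
next
  case (insert q Q)
  then obtain S where S: "finite S" "S \<subseteq> K"
    "\<And>F. fspan Q F \<Longrightarrow> (\<forall>s\<in>S. F s = 0) \<Longrightarrow> (\<forall>x\<in>K. F x = 0)" by blast
  show ?case
  \<comment> \<open>If some \<open>q + G\<close> vanishes on \<open>S\<close> but not at
    \<open>s\<close>, adding \<open>s\<close> detects the coefficient \<open>c\<close> of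
    \<open>q\<close>: subtracting \<open>c * (q + G)\<close> leads back to the span of
    \<open>Q\<close>. Otherwise \<open>S\<close> itself suffices.\<close>
  proof (cases "\<exists>G. fspan Q G \<and> (\<forall>s\<in>S. q s + G s = 0) \<and> (\<exists>s\<in>K. q s + G s \<noteq> 0)")
    case True
    then obtain G s where G: "fspan Q G" "\<forall>s\<in>S. q s + G s = 0" "s \<in> K" "q s + G s \<noteq> 0" by blast
    have *: "F x = 0" if F: "fspan (insert q Q) F" "\<forall>t\<in>insert s S. F t = 0" and x: "x \<in> K" for F x
    proof -
      obtain c H where H: "fspan Q H" "\<And>x. F x = c * q x + H x"
        using fspan_insert[OF F(1)] by blast
      have eq: "F x - c * (q x + G x) = H x + (- c) * G x" for x
        by (simp add: H(2) algebra_simps)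
      have "fspan Q (\<lambda>x. H x + (- c) * G x)"
        by (intro fspan_add fspan_scale H G)
      then have "fspan Q (\<lambda>x. F x - c * (q x + G x))"
        unfolding eq .
      moreover have "\<forall>t\<in>S. F t - c * (q t + G t) = 0"
        using F(2) G(2) by simp
      ultimately have *: "\<forall>x\<in>K. F x - c * (q x + G x) = 0" by (rule S(3))
      then have "c * (q s + G s) = 0" using F(2) G(3) by fastforce
      then have "c = 0" using G(4) by simp
      then show ?thesis using * x by simp
    qed
    have "finite (insert s S)" "insert s S \<subseteq> K" using S(1,2) G(3) by simp_all
    with * show ?thesis by blast
  next
    case False
    have "F x = 0" if F: "fspan (insert q Q) F" "\<forall>t\<in>S. F t = 0" and x: "x \<in> K" for F x
    proof -
      obtain c H where H: "fspan Q H" "\<And>x. F x = c * q x + H x"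
        using fspan_insert[OF F(1)] by blast
      show ?thesis
      proof (cases "c = 0")
        case True
        then show ?thesis using S(3)[OF H(1)] H(2) F(2) x by auto
      next
        case c: False
        \<comment> \<open>Dividing by \<open>c\<close> gives \<open>F\<close> the shape
          \<open>q + G\<close> excluded by the case assumption.\<close>
        have "fspan Q (\<lambda>x. (1 / c) * H x)" by (intro fspan_scale H)
        moreover have eq: "q y + (1 / c) * H y = F y / c" for y
          using c by (simp add: H(2) field_simps)
        ultimately have "q x + (1 / c) * H x = 0"
          using False F(2) x by (metis div_0)
        then show ?thesis using eq[of x] c by simp
      qed
    qed
    then show ?thesis using S by blast
  qed
qed

section \<open>Positive polynomials in the Bernstein basis\<close>

text \<open>The coefficient of \<open>x ^ j\<close> at index \<open>a\<close> in the Bernstein basis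
  of degree \<open>N\<close>. For j \<le> a \<le> N it is the product of (a - i) / (N - i) over i <
  j, hence close to \<open>(a / N) ^ j\<close> for large \<open>N\<close>.\<close>

definition binomial_ratio :: "nat \<Rightarrow> nat \<Rightarrow> nat \<Rightarrow> real"
  where "binomial_ratio N a j = real (a choose j) / real (N choose j)"

text \<open>By (N choose a)(a choose j) = (N choose j)(N - j choose a - j), the sum is
  \<open>x ^ j\<close> times the sum of all Bernstein polynomials of degree \<open>N - j\<close>,
  which is 1.\<close>

lemma power_eq_sum_Bernstein:
  assumes "j \<le> N"
  shows "x ^ j = (\<Sum>a\<le>N. binomial_ratio N a j * Bernstein N a x)"
proof -
  have "(\<Sum>a\<le>N. binomial_ratio N a j * Bernstein N a x)
      = (\<Sum>a\<in>{j..N}. binomial_ratio N a j * Bernstein N a x)"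
    by (intro sum.mono_neutral_right) (auto simp: binomial_ratio_def binomial_eq_0_iff)
  also have "\<dots> = (\<Sum>a\<in>{j..N}. real ((N - j) choose (a - j)) * x ^ a * (1 - x) ^ (N - a))"
  proof (rule sum.cong[OF refl])
    fix a assume a: "a \<in> {j..N}"
    have "real (N choose a) * real (a choose j) = real (N choose j) * real ((N - j) choose (a - j))"
      using choose_mult[of j a N] a by (metis atLeastAtMost_iff of_nat_mult)
    moreover have "real (N choose j) \<noteq> 0" using assms by simp
    ultimately have "binomial_ratio N a j * real (N choose a) = real ((N - j) choose (a - j))"
      unfolding binomial_ratio_def by (simp add: field_simps)
    then show "binomial_ratio N a j * Bernstein N a x
        = real ((N - j) choose (a - j)) * x ^ a * (1 - x) ^ (N - a)"
      unfolding Bernstein_def by (metis mult.assoc)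
  qed
  also have "\<dots> = (\<Sum>i\<in>{..N - j}. real ((N - j) choose i) * x ^ (i + j) * (1 - x) ^ (N - j - i))"
    by (rule sum.reindex_bij_witness[of _ "\<lambda>i. i + j" "\<lambda>a. a - j"]) (use assms in auto)
  also have "\<dots> = x ^ j * (\<Sum>i\<le>N - j. Bernstein (N - j) i x)"
    unfolding sum_distrib_left Bernstein_def
    by (intro sum.cong) (auto simp: power_add algebra_simps)
  finally show ?thesis by simp
qed

text \<open>Both sides are products of \<open>j\<close> factors in [0, 1], and corresponding factors
  differ by at most \<open>j / (N - j)\<close>. If \<open>a < j\<close> the ratio is 0 and
  \<open>(a / N) ^ j\<close> is itself small.\<close>

lemma binomial_ratio_approx:
  assumes "j < N" "a \<le> N"
  shows "\<bar>binomial_ratio N a j - (a / N) ^ j\<bar> \<le> j * (j / (N - j))"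
proof (cases "j \<le> a")
  case True
  have bound: "norm (real (a - i) / real (N - i) - a / N) \<le> j / (N - j)" if "i < j" for i
  proof -
    have "real i < real N" and i: "i \<le> a" "i \<le> N" using that assms True by auto
    then have "a / N - real (a - i) / real (N - i) = (i / (N - i)) * ((N - a) / N)"
      using assms by (simp add: field_simps of_nat_diff)
    moreover have "0 \<le> i / (N - i) * (real (N - a) / N)" by simp
    moreover have "i / (N - i) * (real (N - a) / N) \<le> i / (N - i) * 1"
      by (intro mult_left_mono) (use assms in \<open>auto simp: divide_simps\<close>)
    moreover have "real i / real (N - i) \<le> real j / real (N - j)"
      using that assms by (intro frac_le) auto
    ultimately show ?thesis by (smt (verit) real_norm_def)
  qed
  have nz: "real (j - i) \<noteq> 0" if "i \<in> {0..<j}" for i using that by simp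
  have "binomial_ratio N a j = (\<Prod>i = 0..<j. real (a - i) / real (N - i))"
  proof -
    have "binomial_ratio N a j = (\<Prod>i = 0..<j. real (a - i) / real (j - i)) / (\<Prod>i = 0..<j. real (N - i) / real (j - i))"
      using True assms by (simp add: binomial_ratio_def binomial_altdef_of_nat)
    also have "\<dots> = (\<Prod>i = 0..<j. (real (a - i) / real (j - i)) / (real (N - i) / real (j - i)))"
      by (rule prod_dividef[symmetric])
    also have "\<dots> = (\<Prod>i = 0..<j. real (a - i) / real (N - i))"
      by (intro prod.cong refl) (use nz in \<open>simp add: field_simps del: of_nat_diff\<close>)
    finally show ?thesis .
  qed
  also have "norm (\<dots> - (\<Prod>i = 0..<j. a / N)) \<le> (\<Sum>i = 0..<j. norm (real (a - i) / real (N - i) - a / N))"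
    using assms by (intro norm_prod_diff) (auto simp: divide_simps)
  also have "\<dots> \<le> (\<Sum>i = 0..<j. j / (N - j))"
    by (intro sum_mono bound) auto
  finally show ?thesis using assms by (simp add: of_nat_diff)
next
  case False
  have "(a / N) ^ j \<le> (a / N) ^ 1"
    using False assms by (intro power_decreasing) (auto simp: divide_simps)
  also have "\<dots> \<le> j / (N - j)"
    using False assms by (simp) (intro frac_le; auto)
  also have "\<dots> \<le> j * (j / (N - j))"
    using False assms mult_right_mono[of 1 "real j" "j / (real N - real j)"] by simp
  finally show ?thesis
    using False assms by (simp add: binomial_ratio_def binomial_eq_0 of_nat_diff)
qed

lemma binomial_ratio_le_1: "a \<le> N \<Longrightarrow> \<bar>binomial_ratio N a j\<bar> \<le> 1"
  using binomial_right_mono[of a N j]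
  by (cases "N choose j = 0") (auto simp: binomial_ratio_def divide_simps)

lemma binomial_ratio_eventually:
  assumes "e > 0"
  shows "\<forall>\<^sub>F N in sequentially. j < N \<and> (\<forall>a\<le>N. \<bar>binomial_ratio N a j - (a / N) ^ j\<bar> \<le> e)"
  \<comment> \<open>Beyond this threshold \<open>j * j / e < N - j\<close>, which bounds the error
    of \<open>binomial_ratio_approx\<close> by \<open>e\<close>.\<close>
  using eventually_gt_at_top[of "j + nat \<lceil>j * j / e\<rceil>"]
proof eventually_elim
  case (elim N)
  then have N: "j < N" "j * j / e < N - j" by linarith+
  then have e: "real j * (j / (real N - real j)) \<le> e"
    using assms by (simp add: field_simps)
  show ?case
    using N(1) order_trans[OF binomial_ratio_approx[OF N(1)] e] by blast
qed

section \<open>Bernstein expansions in several variables\<close>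

text \<open>Multi-indices are extensional functions, so the bounded ones form a finite set and
  \<open>prod_sum_PiE\<close> applies. The second clause compares a coefficient with the value at
  the grid point of the same index; through it positivity of a function passes to its
  coefficients.\<close>

definition bernstein_coeffs ::
    "'b set \<Rightarrow> nat \<Rightarrow> (('b \<Rightarrow> real) \<Rightarrow> real) \<Rightarrow> real \<Rightarrow> (('b \<Rightarrow> nat) \<Rightarrow> real) \<Rightarrow> bool"
  where "bernstein_coeffs Bs N F e \<beta> \<longleftrightarrow>
    (\<forall>t. F t = (\<Sum>\<alpha>\<in>Bs \<rightarrow>\<^sub>E {..N}. \<beta> \<alpha> * (\<Prod>b\<in>Bs. Bernstein N (\<alpha> b) (t b)))) \<and>
    (\<forall>\<alpha>\<in>Bs \<rightarrow>\<^sub>E {..N}. \<bar>\<beta> \<alpha> - F (\<lambda>b. \<alpha> b / N)\<bar> \<le> e)"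

lemma bernstein_coeffsD:
  assumes "bernstein_coeffs Bs N F e \<beta>"
  shows "F t = (\<Sum>\<alpha>\<in>Bs \<rightarrow>\<^sub>E {..N}. \<beta> \<alpha> * (\<Prod>b\<in>Bs. Bernstein N (\<alpha> b) (t b)))"
    and "\<alpha> \<in> Bs \<rightarrow>\<^sub>E {..N} \<Longrightarrow> \<bar>\<beta> \<alpha> - F (\<lambda>b. \<alpha> b / N)\<bar> \<le> e"
  using assms unfolding bernstein_coeffs_def by auto

text \<open>Asked for all large \<open>N\<close>, so that two functions can be expanded in a common
  degree before they are added.\<close>

definition bernstein_approx :: "'b set \<Rightarrow> (('b \<Rightarrow> real) \<Rightarrow> real) \<Rightarrow> bool"
  where "bernstein_approx Bs F \<longleftrightarrow> (\<forall>e>0. \<forall>\<^sub>F N in sequentially. \<exists>\<beta>. bernstein_coeffs Bs N F e \<beta>)"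

text \<open>The product of the one-variable expansions. Factors are bounded by 1 in absolute value,
  so the errors of the single variables just add up.\<close>

lemma bernstein_approx_monomial:
  assumes "finite Bs"
  shows "bernstein_approx Bs (\<lambda>t. \<Prod>b\<in>Bs. t b ^ J b)"
  unfolding bernstein_approx_def
proof (intro allI impI)
  fix e :: real assume "e > 0"
  \<comment> \<open>The errors of \<open>card Bs\<close> variables add up to at most
    \<open>e\<close>; the 1 covers empty \<open>Bs\<close>.\<close>
  define d where "d = e / (card Bs + 1)"
  have d: "d > 0" "card Bs * d \<le> e"
    using \<open>e > 0\<close> by (auto simp: d_def field_simps)
  have "\<forall>\<^sub>F N in sequentially. \<forall>b\<in>Bs. J b < N \<and>
      (\<forall>a\<le>N. \<bar>binomial_ratio N a (J b) - (a / N) ^ J b\<bar> \<le> d)"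
    using assms d(1) by (intro eventually_ball_finite ballI binomial_ratio_eventually)
  then show "\<forall>\<^sub>F N in sequentially. \<exists>\<beta>. bernstein_coeffs Bs N (\<lambda>t. \<Prod>b\<in>Bs. t b ^ J b) e \<beta>"
  proof eventually_elim
    case (elim N)
    define \<beta> where "\<beta> \<alpha> = (\<Prod>b\<in>Bs. binomial_ratio N (\<alpha> b) (J b))" for \<alpha>
    have "(\<Prod>b\<in>Bs. t b ^ J b)
        = (\<Sum>\<alpha>\<in>Bs \<rightarrow>\<^sub>E {..N}. \<beta> \<alpha> * (\<Prod>b\<in>Bs. Bernstein N (\<alpha> b) (t b)))" for t
    proof -
      have "(\<Prod>b\<in>Bs. t b ^ J b)
          = (\<Prod>b\<in>Bs. \<Sum>a\<le>N. binomial_ratio N a (J b) * Bernstein N a (t b))"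
        using elim by (intro prod.cong refl power_eq_sum_Bernstein) auto
      also have "\<dots> = (\<Sum>\<alpha>\<in>Bs \<rightarrow>\<^sub>E {..N}. \<Prod>b\<in>Bs. binomial_ratio N (\<alpha> b) (J b) * Bernstein N (\<alpha> b) (t b))"
        using assms by (subst prod_sum_PiE) auto
      finally show ?thesis by (simp add: prod.distrib \<beta>_def)
    qed
    moreover have "\<bar>\<beta> \<alpha> - (\<Prod>b\<in>Bs. (\<alpha> b / N) ^ J b)\<bar> \<le> e" if "\<alpha> \<in> Bs \<rightarrow>\<^sub>E {..N}" for \<alpha>
    proof -
      have \<alpha>: "\<alpha> b \<le> N" if "b \<in> Bs" for b using \<open>\<alpha> \<in> _\<close> that by auto
      have "norm (\<beta> \<alpha> - (\<Prod>b\<in>Bs. (\<alpha> b / N) ^ J b))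
          \<le> (\<Sum>b\<in>Bs. norm (binomial_ratio N (\<alpha> b) (J b) - (\<alpha> b / N) ^ J b))"
        unfolding \<beta>_def
        using \<alpha> by (intro norm_prod_diff)
          (auto simp: binomial_ratio_le_1 divide_simps power_le_one intro!: power_mono)
      also have "\<dots> \<le> (\<Sum>b\<in>Bs. d)"
        using elim \<alpha> by (intro sum_mono) auto
      also have "\<dots> \<le> e" using d by simp
      finally show ?thesis by simp
    qed
    ultimately show ?case unfolding bernstein_coeffs_def by blast
  qed
qed

lemma bernstein_approx_add:
  assumes "bernstein_approx Bs F" "bernstein_approx Bs G"
  shows "bernstein_approx Bs (\<lambda>t. F t + G t)"
  unfolding bernstein_approx_def
proof (intro allI impI)
  fix e :: real assume "e > 0"
  then have "e / 2 > 0" by simp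
  with assms have "\<forall>\<^sub>F N in sequentially. \<exists>\<beta>. bernstein_coeffs Bs N F (e / 2) \<beta>"
    "\<forall>\<^sub>F N in sequentially. \<exists>\<beta>. bernstein_coeffs Bs N G (e / 2) \<beta>"
    unfolding bernstein_approx_def by blast+
  then show "\<forall>\<^sub>F N in sequentially. \<exists>\<beta>. bernstein_coeffs Bs N (\<lambda>t. F t + G t) e \<beta>"
  proof eventually_elim
    case (elim N)
    from elim(1) obtain \<beta> where \<beta>: "bernstein_coeffs Bs N F (e / 2) \<beta>" ..
    from elim(2) obtain \<gamma> where \<gamma>: "bernstein_coeffs Bs N G (e / 2) \<gamma>" ..
    have "F t + G t
        = (\<Sum>\<alpha>\<in>Bs \<rightarrow>\<^sub>E {..N}. (\<beta> \<alpha> + \<gamma> \<alpha>) * (\<Prod>b\<in>Bs. Bernstein N (\<alpha> b) (t b)))" for t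
      unfolding bernstein_coeffsD(1)[OF \<beta>, of t] bernstein_coeffsD(1)[OF \<gamma>, of t]
        distrib_right sum.distrib ..
    moreover have "\<bar>\<beta> \<alpha> + \<gamma> \<alpha> - (F (\<lambda>b. \<alpha> b / N) + G (\<lambda>b. \<alpha> b / N))\<bar> \<le> e"
      if "\<alpha> \<in> Bs \<rightarrow>\<^sub>E {..N}" for \<alpha>
      using bernstein_coeffsD(2)[OF \<beta> that] bernstein_coeffsD(2)[OF \<gamma> that] by linarith
    ultimately show ?case
      unfolding bernstein_coeffs_def by (intro exI[of _ "\<lambda>\<alpha>. \<beta> \<alpha> + \<gamma> \<alpha>"] conjI ballI allI)
  qed
qed

lemma bernstein_approx_scale:
  assumes "bernstein_approx Bs F"
  shows "bernstein_approx Bs (\<lambda>t. c * F t)"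
  unfolding bernstein_approx_def
proof (intro allI impI)
  fix e :: real assume "e > 0"
  \<comment> \<open>The 1 covers \<open>c = 0\<close>.\<close>
  then have "e / (\<bar>c\<bar> + 1) > 0" by (simp add: add_nonneg_pos)
  with assms have "\<forall>\<^sub>F N in sequentially. \<exists>\<beta>. bernstein_coeffs Bs N F (e / (\<bar>c\<bar> + 1)) \<beta>"
    unfolding bernstein_approx_def by blast
  then show "\<forall>\<^sub>F N in sequentially. \<exists>\<beta>. bernstein_coeffs Bs N (\<lambda>t. c * F t) e \<beta>"
  proof eventually_elim
    case (elim N)
    then obtain \<beta> where \<beta>: "bernstein_coeffs Bs N F (e / (\<bar>c\<bar> + 1)) \<beta>" ..
    have "c * F t
        = (\<Sum>\<alpha>\<in>Bs \<rightarrow>\<^sub>E {..N}. (c * \<beta> \<alpha>) * (\<Prod>b\<in>Bs. Bernstein N (\<alpha> b) (t b)))" for t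
      unfolding bernstein_coeffsD(1)[OF \<beta>, of t] sum_distrib_left mult.assoc ..
    moreover have "\<bar>c * \<beta> \<alpha> - c * F (\<lambda>b. \<alpha> b / N)\<bar> \<le> e"
      if "\<alpha> \<in> Bs \<rightarrow>\<^sub>E {..N}" for \<alpha>
    proof -
      have "\<bar>c * \<beta> \<alpha> - c * F (\<lambda>b. \<alpha> b / N)\<bar> = \<bar>c\<bar> * \<bar>\<beta> \<alpha> - F (\<lambda>b. \<alpha> b / N)\<bar>"
        by (simp flip: abs_mult right_diff_distrib)
      also have "\<dots> \<le> (\<bar>c\<bar> + 1) * (e / (\<bar>c\<bar> + 1))"
        using bernstein_coeffsD(2)[OF \<beta> that] by (intro mult_mono) auto
      also have "\<dots> = e" by (simp add: add_nonneg_eq_0_iff)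
      finally show ?thesis .
    qed
    ultimately show ?case
      unfolding bernstein_coeffs_def by (intro exI[of _ "\<lambda>\<alpha>. c * \<beta> \<alpha>"] conjI ballI allI)
  qed
qed

lemma bernstein_approx_fspan:
  assumes "finite Bs" "fspan (range (\<lambda>J t. \<Prod>b\<in>Bs. t b ^ J b)) F"
  shows "bernstein_approx Bs F"
  using assms(2)
proof (induction rule: fspan.induct)
  case zero
  then show ?case
    using bernstein_approx_scale[OF bernstein_approx_monomial[OF assms(1), of "\<lambda>_. 0"], of 0] by simp
next
  case (step q F c)
  then show ?case
    using assms(1) by (intro bernstein_approx_add bernstein_approx_scale)
      (auto intro: bernstein_approx_monomial)
qed

text \<open>The substitution 2t - 1 carries the unit cube, where Bernstein polynomials live, to the
  cube from -1 to 1 that contains the unit sphere.\<close>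

lemma polynomial_fspan_monomials:
  fixes p :: "'v::euclidean_space \<Rightarrow> real"
  assumes "real_polynomial_function p"
  shows "fspan (range (\<lambda>J t. \<Prod>b\<in>Basis. t b ^ J b)) (\<lambda>t. p (\<Sum>b\<in>Basis. (2 * t b - 1) *\<^sub>R b))"
proof -
  let ?Q = "range (\<lambda>J t. \<Prod>b\<in>(Basis :: 'v set). (t b :: real) ^ J b)"
  let ?x = "\<lambda>t. \<Sum>b\<in>(Basis :: 'v set). (2 * t b - 1 :: real) *\<^sub>R b"
  \<comment> \<open>Strengthened to multiplication of an arbitrary \<open>F\<close> in the span: the
    product case of the induction is then two successive multiplications. At the end
    \<open>F\<close> is the monomial with all exponents 0.\<close>
  have "fspan ?Q (\<lambda>t. p (?x t) * F t)" if "fspan ?Q F" for F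
    using assms that
  proof (induction arbitrary: F rule: real_polynomial_function.induct)
    case (linear f)
    interpret bounded_linear f by fact
    have coord: "fspan ?Q (\<lambda>t. t b * F t)" if b: "b \<in> Basis" for b
    proof (rule fspan_compose_mult[where h = "\<lambda>x. x", OF linear.prems])
      fix q assume "q \<in> ?Q"
      then obtain J where J: "q = (\<lambda>t. \<Prod>b\<in>(Basis :: 'v set). t b ^ J b)" by blast
      have "t b * q t = (\<Prod>b'\<in>Basis. t b' ^ (J(b := Suc (J b))) b')" for t :: "'v \<Rightarrow> real"
      proof -
        have "(\<Prod>b'\<in>Basis - {b}. t b' ^ (J(b := Suc (J b))) b') = (\<Prod>b'\<in>Basis - {b}. t b' ^ J b')"
          by (intro prod.cong) auto
        then show ?thesis using b by (subst prod.remove[of _ b]) (simp_all add: J prod.remove[of _ b] mult.assoc)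
      qed
      then show "fspan ?Q (\<lambda>t. t b * q t)" by (intro fspan_base) auto
    qed
    have eq: "f (?x t) * F t = (\<Sum>b\<in>Basis. 2 * f b * (t b * F t) + (- f b) * F t)" for t
    proof -
      have "f (?x t) * F t = (\<Sum>b\<in>Basis. (2 * t b - 1) * f b * F t)"
        by (simp add: sum scaleR sum_distrib_right)
      also have "\<dots> = (\<Sum>b\<in>Basis. 2 * f b * (t b * F t) + (- f b) * F t)"
        by (intro sum.cong) (auto simp: algebra_simps)
      finally show ?thesis .
    qed
    show ?case
      unfolding eq using linear.prems by (intro fspan_sum fspan_add fspan_scale coord)
  next
    case (const c)
    then show ?case by (rule fspan_scale)
  next
    case (add f g)
    then show ?case using fspan_add[of ?Q "\<lambda>t. f (?x t) * F t" "\<lambda>t. g (?x t) * F t"]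
      by (simp add: algebra_simps)
  next
    case (mult f g)
    then show ?case by (simp add: mult.assoc)
  qed
  moreover have "fspan ?Q (\<lambda>t. \<Prod>b\<in>Basis. t b ^ 0)"
    by (rule fspan_base, rule image_eqI[where x = "\<lambda>_. 0"]) simp_all
  ultimately have "fspan ?Q (\<lambda>t. p (?x t) * (\<Prod>b\<in>(Basis :: 'v set). t b ^ 0))" by blast
  then show ?thesis by simp
qed

lemma positive_polynomial_bernstein:
  fixes p :: "'v::euclidean_space \<Rightarrow> real"
  assumes p: "real_polynomial_function p" and pos: "\<And>x. x \<in> cbox (- One) One \<Longrightarrow> p x > 0"
  shows "\<exists>N \<beta>. (\<forall>\<alpha>\<in>Basis \<rightarrow>\<^sub>E {..N}. \<beta> \<alpha> \<ge> 0) \<and>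
    (\<forall>x. p x = (\<Sum>\<alpha>\<in>Basis \<rightarrow>\<^sub>E {..N}. \<beta> \<alpha> * (\<Prod>b\<in>Basis. Bernstein N (\<alpha> b) ((1 + x \<bullet> b) / 2))))"
proof -
  have "continuous_on (cbox (- One) One) p"
    using p by (simp add: continuous_on_polymonial_function real_polynomial_function_eq)
  moreover have "(0 :: 'v) \<in> cbox (- One) One" by (simp add: mem_box)
  ultimately obtain x0 where x0: "x0 \<in> cbox (- One) One" "\<And>x. x \<in> cbox (- One) One \<Longrightarrow> p x0 \<le> p x"
    using continuous_attains_inf[of "cbox (- One) One" p] by (metis compact_cbox empty_iff)
  let ?x = "\<lambda>t. \<Sum>b\<in>(Basis :: 'v set). (2 * t b - 1 :: real) *\<^sub>R b"
  have "bernstein_approx Basis (\<lambda>t. p (?x t))"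
    by (intro bernstein_approx_fspan finite_Basis polynomial_fspan_monomials p)
  with pos[OF x0(1)] have "\<forall>\<^sub>F N in sequentially. \<exists>\<beta>. bernstein_coeffs Basis N (\<lambda>t. p (?x t)) (p x0) \<beta>"
    unfolding bernstein_approx_def by blast
  then have "\<forall>\<^sub>F N in sequentially. 0 < N \<and> (\<exists>\<beta>. bernstein_coeffs Basis N (\<lambda>t. p (?x t)) (p x0) \<beta>)"
    using eventually_gt_at_top[of 0] by eventually_elim blast
  from eventually_happens'[OF sequentially_bot this]
  obtain N \<beta> where N: "N > 0" and \<beta>: "bernstein_coeffs Basis N (\<lambda>t. p (?x t)) (p x0) \<beta>"
    by blast
  have "\<beta> \<alpha> \<ge> 0" if \<alpha>: "\<alpha> \<in> Basis \<rightarrow>\<^sub>E {..N}" for \<alpha>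
  proof -
    have "?x (\<lambda>b. \<alpha> b / N) \<in> cbox (- One) One"
      using N PiE_mem[OF \<alpha>] by (auto simp: mem_box field_simps)
    from x0(2)[OF this] bernstein_coeffsD(2)[OF \<beta> \<alpha>] show ?thesis by linarith
  qed
  moreover have "p x = (\<Sum>\<alpha>\<in>Basis \<rightarrow>\<^sub>E {..N}. \<beta> \<alpha> * (\<Prod>b\<in>Basis. Bernstein N (\<alpha> b) ((1 + x \<bullet> b) / 2)))" for x
  proof -
    have "?x (\<lambda>b. (1 + x \<bullet> b) / 2) = x"
      by (subst (2) euclidean_representation[of x, symmetric]) (intro sum.cong, simp_all add: field_simps)
    then show ?thesis
      using bernstein_coeffsD(1)[OF \<beta>, of "\<lambda>b. (1 + x \<bullet> b) / 2"] by simp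
  qed
  ultimately show ?thesis by blast
qed

section \<open>Sums of squares\<close>

text \<open>Only values on \<open>K\<close> count, so the equations of \<open>K\<close> may be used
  when a function is rewritten. No degree is recorded, which keeps the notion closed under
  products.\<close>

inductive sos_on :: "'v::real_normed_vector set \<Rightarrow> ('v \<Rightarrow> real) \<Rightarrow> bool" for K where
  square: "real_polynomial_function p \<Longrightarrow> (\<And>x. x \<in> K \<Longrightarrow> F x = (p x)\<^sup>2) \<Longrightarrow> sos_on K F"
| add: "sos_on K F \<Longrightarrow> sos_on K G \<Longrightarrow> (\<And>x. x \<in> K \<Longrightarrow> H x = F x + G x) \<Longrightarrow> sos_on K H"

lemma sos_on_const: "c \<ge> 0 \<Longrightarrow> sos_on K (\<lambda>_. c)"
  by (rule sos_on.square[where p = "\<lambda>_. sqrt c"]) auto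

lemma sos_on_add: "sos_on K F \<Longrightarrow> sos_on K G \<Longrightarrow> sos_on K (\<lambda>x. F x + G x)"
  by (rule sos_on.add[where F = F and G = G]) simp_all

lemma sos_on_cong:
  assumes "sos_on K F" "\<And>x. x \<in> K \<Longrightarrow> G x = F x"
  shows "sos_on K G"
  by (rule sos_on.add[OF assms(1) sos_on_const[of 0]]) (simp_all add: assms(2))

lemma sos_on_sum:
  assumes "\<And>i. i \<in> I \<Longrightarrow> sos_on K (F i)"
  shows "sos_on K (\<lambda>x. \<Sum>i\<in>I. F i x)"
  using assms by (induction I rule: infinite_finite_induct) (simp_all add: sos_on_const sos_on_add)

lemma sos_on_mult:
  assumes "sos_on K F" "sos_on K G"
  shows "sos_on K (\<lambda>x. F x * G x)"
  using assms
proof (induction arbitrary: G rule: sos_on.induct)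
  case F: (square p F)
  from F.prems show ?case
  proof (induction rule: sos_on.induct)
    case G: (square q G)
    have "real_polynomial_function (\<lambda>x. p x * q x)" using F.hyps(1) G.hyps(1) by blast
    then show ?case
      by (rule sos_on.square) (simp add: F.hyps(2) G.hyps(2) power_mult_distrib)
  next
    case (add G1 G2 H)
    show ?case
      by (rule sos_on.add[OF add.IH]) (simp add: add.hyps(3) distrib_left)
  qed
next
  case (add F1 F2 H)
  show ?case
    by (rule sos_on.add[OF add.IH(1)[OF add.prems] add.IH(2)[OF add.prems]])
      (simp add: add.hyps(3) distrib_right)
qed

lemma sos_on_prod:
  assumes "\<And>i. i \<in> I \<Longrightarrow> sos_on K (F i)"
  shows "sos_on K (\<lambda>x. \<Prod>i\<in>I. F i x)"
  using assms by (induction I rule: infinite_finite_induct) (simp_all add: sos_on_const sos_on_mult)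

lemma sos_on_power: "sos_on K F \<Longrightarrow> sos_on K (\<lambda>x. F x ^ n)"
  by (induction n) (simp_all add: sos_on_const sos_on_mult)

text \<open>For u = (1 + s x_b) / 2 with s = 1 or -1 one has u - u^2 = (1 - x_b^2) / 4, and on the
  unit sphere 1 - x_b^2 is the sum of the squares of the other coordinates.\<close>

lemma sos_on_coordinate:
  fixes K :: "'v::euclidean_space set"
  assumes "K \<subseteq> sphere 0 1" "b \<in> Basis" "s\<^sup>2 = 1"
  shows "sos_on K (\<lambda>x. (1 + s * (x \<bullet> b)) / 2)"
proof (rule sos_on.add)
  have lin: "real_polynomial_function (\<lambda>x. x \<bullet> b')" for b' :: 'v
    by (intro real_polynomial_function.intros(1) bounded_linear_inner_left)
  have "real_polynomial_function (\<lambda>x. (1 + s * (x \<bullet> b)) / 2)"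
    by (intro real_polynomial_function_divide real_polynomial_function.intros(2-4) lin)
  then show "sos_on K (\<lambda>x. ((1 + s * (x \<bullet> b)) / 2)\<^sup>2)"
    by (rule sos_on.square) simp
  show "sos_on K (\<lambda>x. \<Sum>b'\<in>Basis - {b}. (x \<bullet> b' / 2)\<^sup>2)"
  proof (rule sos_on_sum)
    fix b' :: 'v
    have "real_polynomial_function (\<lambda>x. x \<bullet> b' / 2)"
      by (intro real_polynomial_function_divide lin)
    then show "sos_on K (\<lambda>x. (x \<bullet> b' / 2)\<^sup>2)" by (rule sos_on.square) simp
  qed
  fix x assume "x \<in> K"
  then have "1 = x \<bullet> x"
    using assms(1) by (auto simp: dot_square_norm)
  also have "\<dots> = (\<Sum>b'\<in>Basis. (x \<bullet> b')\<^sup>2)"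
    by (subst euclidean_inner) (simp add: power2_eq_square)
  also have "\<dots> = (x \<bullet> b)\<^sup>2 + (\<Sum>b'\<in>Basis - {b}. (x \<bullet> b')\<^sup>2)"
    using assms(2) by (simp add: sum.remove)
  finally have *: "(\<Sum>b'\<in>Basis - {b}. (x \<bullet> b')\<^sup>2) = 1 - (x \<bullet> b)\<^sup>2" by simp
  have "(\<Sum>b'\<in>Basis - {b}. (x \<bullet> b' / 2)\<^sup>2) = (\<Sum>b'\<in>Basis - {b}. (x \<bullet> b')\<^sup>2) / 4"
    by (simp add: sum_divide_distrib power_divide)
  moreover have "((1 + s * (x \<bullet> b)) / 2)\<^sup>2 = (1 + 2 * s * (x \<bullet> b) + s\<^sup>2 * (x \<bullet> b)\<^sup>2) / 4"
    by (simp add: power2_eq_square field_simps)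
  ultimately show "(1 + s * (x \<bullet> b)) / 2
      = ((1 + s * (x \<bullet> b)) / 2)\<^sup>2 + (\<Sum>b'\<in>Basis - {b}. (x \<bullet> b' / 2)\<^sup>2)"
    unfolding * by (simp add: assms(3) field_simps)
qed

lemma sos_on_Bernstein:
  fixes K :: "'v::euclidean_space set"
  assumes "K \<subseteq> sphere 0 1" "b \<in> Basis"
  shows "sos_on K (\<lambda>x. Bernstein N a ((1 + x \<bullet> b) / 2))"
proof -
  have "sos_on K (\<lambda>x. (1 + x \<bullet> b) / 2)" "sos_on K (\<lambda>x. 1 - (1 + x \<bullet> b) / 2)"
    using sos_on_coordinate[OF assms, of 1] sos_on_coordinate[OF assms, of "-1"]
    by (simp_all add: field_simps)
  then show ?thesis
    unfolding Bernstein_def by (intro sos_on_mult sos_on_power sos_on_const) auto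
qed

text \<open>A multiple of the equation \<open>(\<bar>x\<bar>\<^sup>2 - 1)\<^sup>2 + h\<^sup>2\<close> of \<open>K\<close> is added to make \<open>F\<close> positive on the
  whole cube; in the Bernstein expansion of the result every factor is a sum of squares on the sphere.\<close>

lemma positive_polynomial_sos_on:
  fixes F h :: "'v::euclidean_space \<Rightarrow> real"
  assumes F: "real_polynomial_function F" and h: "real_polynomial_function h"
    and pos: "\<And>x. norm x = 1 \<Longrightarrow> h x = 0 \<Longrightarrow> F x > 0"
  shows "sos_on {x. norm x = 1 \<and> h x = 0} F"
proof -
  let ?K = "{x. norm x = 1 \<and> h x = 0}"
  define H where "H x = (x \<bullet> x - 1)\<^sup>2 + (h x)\<^sup>2" for x
  have "real_polynomial_function (\<lambda>x :: 'v. x \<bullet> x)"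
    by (subst euclidean_inner) (intro real_polynomial_function_sum finite_Basis
        real_polynomial_function.intros(1,4) bounded_linear_inner_left)
  then have H: "real_polynomial_function H"
    unfolding H_def[abs_def] using h
    by (intro real_polynomial_function.intros(2,3) real_polynomial_function_diff real_polynomial_function_power)
  have H0: "H x = 0 \<longleftrightarrow> x \<in> ?K" "H x \<ge> 0" for x
    by (auto simp: H_def sum_power2_eq_zero_iff norm_eq_1)
  have cont: "continuous_on A F" "continuous_on A H" for A
    using F H by (simp_all add: continuous_on_polymonial_function real_polynomial_function_eq)
  \<comment> \<open>The compact part of the cube where \<open>F\<close> fails to be positive. It
    misses \<open>?K\<close>, so \<open>H\<close> has a positive minimum on it.\<close>
  define N where "N = {x \<in> cbox (- One) One. F x \<le> 0}"
  have N: "compact N"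
  proof -
    have "closed {x. F x \<le> 0}"
      by (intro closed_Collect_le cont continuous_on_const)
    then have "compact (cbox (- One) One \<inter> {x. F x \<le> 0})" by (rule compact_Int_closed[OF compact_cbox])
    then show ?thesis by (simp add: N_def Collect_conj_eq)
  qed
  have "\<exists>C. \<forall>x\<in>N. F x + C * H x > 0"
  proof (cases "N = {}")
    case False
    obtain x1 where x1: "x1 \<in> N" "\<And>x. x \<in> N \<Longrightarrow> F x1 \<le> F x"
      using continuous_attains_inf[OF N False cont(1)] by blast
    obtain x2 where x2: "x2 \<in> N" "\<And>x. x \<in> N \<Longrightarrow> H x2 \<le> H x"
      using continuous_attains_inf[OF N False cont(2)] by blast
    have "H x2 > 0"
    proof (rule ccontr)
      assume "\<not> H x2 > 0"
      then have "x2 \<in> ?K" using H0[of x2] by fastforce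
      then show False using pos[of x2] x2(1) by (simp add: N_def)
    qed
    \<comment> \<open>Chosen so that on \<open>N\<close> the sum is at least
      \<open>F x1 + C * H x2 = 1\<close>.\<close>
    define C where "C = (1 - F x1) / H x2"
    have "F x + C * H x > 0" if "x \<in> N" for x
    proof -
      have "C \<ge> 0" using x1(1) \<open>H x2 > 0\<close> by (auto simp: C_def N_def)
      then have "C * H x2 \<le> C * H x" using x2(2)[OF that] by (rule mult_left_mono[rotated])
      then show ?thesis using x1(2)[OF that] \<open>H x2 > 0\<close> by (simp add: C_def)
    qed
    then show ?thesis by blast
  qed auto
  then obtain C0 where C0: "\<And>x. x \<in> N \<Longrightarrow> F x + C0 * H x > 0" by blast
  \<comment> \<open>\<open>C0\<close> is arbitrary if \<open>N\<close> is empty. A nonnegative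
    constant also preserves positivity off \<open>N\<close>, and enlarging it does no harm on
    \<open>N\<close> because \<open>H\<close> is nonnegative.\<close>
  define C where "C = \<bar>C0\<bar>"
  have "F x + C * H x > 0" if "x \<in> cbox (- One) One" for x
  proof (cases "x \<in> N")
    case True
    have "C0 * H x \<le> C * H x" unfolding C_def using H0(2)[of x] by (intro mult_right_mono) auto
    then show ?thesis using C0[OF True] by linarith
  next
    case False
    then have "F x > 0" using that by (auto simp: N_def)
    moreover have "C * H x \<ge> 0" unfolding C_def using H0(2)[of x] by simp
    ultimately show ?thesis by linarith
  qed
  moreover have "real_polynomial_function (\<lambda>x. F x + C * H x)"
    using F H by (intro real_polynomial_function.intros(2-4))
  ultimately obtain N \<beta> where \<beta>: "\<And>\<alpha>. \<alpha>\<in>Basis \<rightarrow>\<^sub>E {..N} \<Longrightarrow> \<beta> \<alpha> \<ge> 0" and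
    eq: "\<And>x. F x + C * H x
      = (\<Sum>\<alpha>\<in>Basis \<rightarrow>\<^sub>E {..N}. \<beta> \<alpha> * (\<Prod>b\<in>Basis. Bernstein N (\<alpha> b) ((1 + x \<bullet> b) / 2)))"
    using positive_polynomial_bernstein[of "\<lambda>x. F x + C * H x"] by blast
  have "sos_on ?K (\<lambda>x. F x + C * H x)"
    unfolding eq
    by (intro sos_on_sum sos_on_mult sos_on_const sos_on_prod sos_on_Bernstein \<beta>) auto
  then show ?thesis
    by (rule sos_on_cong) (use H0(1) in auto)
qed

section \<open>Polynomials of bounded degree\<close>

primrec monomials :: "nat \<Rightarrow> ('v::euclidean_space \<Rightarrow> real) set" where
  "monomials 0 = {\<lambda>_. 1}"
| "monomials (Suc m) = monomials m \<union> (\<lambda>(e, q) x. (x \<bullet> e) * q x) ` (Basis \<times> monomials m)"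

lemma finite_monomials: "finite (monomials m)"
  by (induction m) auto

lemma monomials_mono: "m \<le> n \<Longrightarrow> monomials m \<subseteq> monomials n"
  by (induction n rule: dec_induct) auto

lemma fspan_monomials_inner:
  assumes "fspan (monomials m) F"
  shows "fspan (monomials (Suc m)) (\<lambda>x. (x \<bullet> u) * F x)"
proof -
  have "fspan (monomials (Suc m)) (\<lambda>x. (x \<bullet> e) * F x)" if "e \<in> Basis" for e
    by (rule fspan_compose_mult[where h = "\<lambda>x. x", OF assms], rule fspan_base)
      (use that in \<open>auto intro!: image_eqI\<close>)
  then have "fspan (monomials (Suc m)) (\<lambda>x. \<Sum>e\<in>Basis. (u \<bullet> e) * ((x \<bullet> e) * F x))"
    by (intro fspan_sum fspan_scale)
  moreover have "(\<Sum>e\<in>Basis. (u \<bullet> e) * ((x \<bullet> e) * F x)) = (x \<bullet> u) * F x" for x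
    unfolding euclidean_inner[of x u] sum_distrib_right by (intro sum.cong refl) (simp only: mult_ac)
  ultimately show ?thesis by simp
qed

lemma fspan_monomials_Suc: "fspan (monomials m) F \<Longrightarrow> fspan (monomials (Suc m)) F"
  by (erule fspan_mono) simp

text \<open>The inner product of \<open>h x\<close> with \<open>e\<close> is that of
  \<open>x\<close> with \<open>adjoint h e\<close>, so a linear substitution does not raise the
  degree. Hence each single level of both hierarchies is invariant.\<close>

lemma fspan_monomials_linear:
  assumes "linear h" "q \<in> monomials m"
  shows "fspan (monomials m) (\<lambda>x. q (h x))"
  using assms(2)
proof (induction m arbitrary: q)
  case 0
  then show ?case by (auto intro: fspan_base)
next
  case (Suc m)
  from Suc.prems consider "q \<in> monomials m"
    | e q' where "q' \<in> monomials m" "q = (\<lambda>x. (x \<bullet> e) * q' x)"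
    by auto
  then show ?case
  proof cases
    case 1
    then show ?thesis by (intro fspan_monomials_Suc Suc.IH)
  next
    case 2
    then show ?thesis
      using fspan_monomials_inner[OF Suc.IH[of q'], of "adjoint h e"]
      by (simp add: adjoint_clauses[OF assms(1)])
  qed
qed

lemma polynomial_fspan_monomials_degree:
  assumes "real_polynomial_function p"
  shows "\<exists>m. fspan (monomials m) p"
proof -
  \<comment> \<open>As before, the induction runs over multiplication by \<open>p\<close>, which
    turns the product case into two multiplications.\<close>
  have "\<exists>n. fspan (monomials n) (\<lambda>x. p x * F x)" if "fspan (monomials m) F" for m F
    using assms that
  proof (induction arbitrary: m F rule: real_polynomial_function.induct)
    case (linear f)
    have "f x = x \<bullet> adjoint f 1" for x
      using adjoint_works[OF bounded_linear.linear[OF linear.hyps], of x 1] by simp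
    then show ?case
      using fspan_monomials_inner[OF linear.prems, of "adjoint f 1"] by (intro exI[of _ "Suc m"]) simp
  next
    case (const c)
    then show ?case using fspan_scale by blast
  next
    case (add f g)
    then obtain n n' where
      "fspan (monomials n) (\<lambda>x. f x * F x)" "fspan (monomials n') (\<lambda>x. g x * F x)" by blast
    then have "fspan (monomials (max n n')) (\<lambda>x. f x * F x + g x * F x)"
      by (intro fspan_add) (auto elim!: fspan_mono intro!: monomials_mono)
    then show ?case by (auto simp: distrib_right)
  next
    case (mult f g)
    then obtain n where "fspan (monomials n) (\<lambda>x. g x * F x)" by blast
    from mult.IH(1)[OF this] show ?case by (simp add: mult.assoc)
  qed
  from this[of 0 "\<lambda>_. 1"] show ?thesis by (simp add: fspan_base)
qed

section \<open>Gram matrix representations\<close>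

definition gram_form :: "nat \<Rightarrow> (nat \<Rightarrow> 'v \<Rightarrow> real) \<Rightarrow> (nat \<Rightarrow> nat \<Rightarrow> real) \<Rightarrow> 'v \<Rightarrow> real"
  where "gram_form r b G x = (\<Sum>a<r. \<Sum>c<r. b a x * G a c * b c x)"

text \<open>The number of squares is not bounded, but a positive semidefinite matrix of fixed size
  \<open>r\<close> encodes any sum of squares of combinations of the \<open>b a\<close>. This makes
  the condition a linear matrix inequality in \<open>G\<close> together with linear
  equations.\<close>

definition gram_rep :: "'v set \<Rightarrow> nat \<Rightarrow> (nat \<Rightarrow> 'v \<Rightarrow> real) \<Rightarrow> ('v \<Rightarrow> real) \<Rightarrow> bool"
  where "gram_rep K r b F \<longleftrightarrow> (\<exists>G. psd_mat r G \<and> (\<forall>x\<in>K. F x = gram_form r b G x))"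

lemma gram_rep_nonneg:
  assumes "gram_rep K r b F" "x \<in> K"
  shows "F x \<ge> 0"
  using assms by (auto simp: gram_rep_def gram_form_def psd_mat_def)

lemma gram_rep_add:
  assumes "gram_rep K r b F" "gram_rep K r b G"
  shows "gram_rep K r b (\<lambda>x. F x + G x)"
proof -
  from assms obtain P Q where P: "psd_mat r P" "\<forall>x\<in>K. F x = gram_form r b P x"
    and Q: "psd_mat r Q" "\<forall>x\<in>K. G x = gram_form r b Q x"
    unfolding gram_rep_def by blast
  have sum: "(\<Sum>a<r. \<Sum>c<r. v a * (P a c + Q a c) * v c)
      = (\<Sum>a<r. \<Sum>c<r. v a * P a c * v c) + (\<Sum>a<r. \<Sum>c<r. v a * Q a c * v c)" for v :: "nat \<Rightarrow> real"
    by (simp add: sum.distrib algebra_simps)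
  have "psd_mat r (\<lambda>a c. P a c + Q a c)"
    using P(1) Q(1) unfolding psd_mat_def sum by (auto simp: sym_mat_def)
  moreover have "gram_form r b (\<lambda>a c. P a c + Q a c) x = gram_form r b P x + gram_form r b Q x" for x
    unfolding gram_form_def by (rule sum)
  ultimately show ?thesis
    using P(2) Q(2) unfolding gram_rep_def by (intro exI[of _ "\<lambda>a c. P a c + Q a c"]) auto
qed

text \<open>The Gram matrix is the rank one matrix of the coefficient vector
  \<open>c\<close>.\<close>

lemma gram_rep_square:
  assumes "\<And>x. x \<in> K \<Longrightarrow> F x = (\<Sum>a<r. c a * b a x)\<^sup>2"
  shows "gram_rep K r b F"
proof -
  have "(\<Sum>a<r. \<Sum>d<r. v a * (c a * c d) * v d) = (\<Sum>a<r. c a * v a)\<^sup>2" for v :: "nat \<Rightarrow> real"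
    by (simp add: power2_eq_square sum_product algebra_simps)
  then show ?thesis
    unfolding gram_rep_def psd_mat_def sym_mat_def gram_form_def
    by (intro exI[of _ "\<lambda>a d. c a * c d"]) (simp add: assms)
qed

text \<open>If the functions b(h x) are obtained from the b'(x) by a matrix \<open>M\<close>, then
  the congruence M^T G M is a Gram matrix for the composition. It serves both to raise the degree
  and to act by the orthogonal group.\<close>

lemma gram_rep_compose:
  assumes F: "gram_rep K r b F" and K: "\<And>x. x \<in> K' \<Longrightarrow> h x \<in> K"
    and span: "\<And>q. q \<in> b ` {..<r} \<Longrightarrow> fspan (b' ` {..<r'}) (\<lambda>x. q (h x))"
  shows "gram_rep K' r' b' (\<lambda>x. F (h x))"
proof -
  have "\<forall>a\<in>{..<r}. \<exists>c. \<forall>x. b a (h x) = (\<Sum>i<r'. c i * b' i x)"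
    using fspan_coeffs[OF span] by blast
  then obtain M where M: "\<And>a x. a < r \<Longrightarrow> b a (h x) = (\<Sum>i<r'. M a i * b' i x)"
    unfolding bchoice_iff by auto
  from F obtain G where G: "psd_mat r G" "\<forall>x\<in>K. F x = gram_form r b G x"
    unfolding gram_rep_def by blast
  define G' where "G' i j = (\<Sum>a<r. \<Sum>c<r. M a i * G a c * M c j)" for i j
  have G': "(\<Sum>i<r'. \<Sum>j<r'. v i * G' i j * v j)
      = (\<Sum>a<r. \<Sum>c<r. (\<Sum>i<r'. M a i * v i) * G a c * (\<Sum>j<r'. M c j * v j))" (is "?l = ?r")
    for v :: "nat \<Rightarrow> real"
  proof -
    have "?l = (\<Sum>i<r'. \<Sum>j<r'. \<Sum>a<r. \<Sum>c<r. M a i * v i * G a c * (M c j * v j))"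
      unfolding G'_def sum_distrib_left sum_distrib_right
      by (intro sum.cong refl) (simp add: algebra_simps)
    also have "\<dots> = (\<Sum>i<r'. \<Sum>a<r. \<Sum>j<r'. \<Sum>c<r. M a i * v i * G a c * (M c j * v j))"
      by (intro sum.cong refl sum.swap)
    also have "\<dots> = (\<Sum>a<r. \<Sum>i<r'. \<Sum>c<r. \<Sum>j<r'. M a i * v i * G a c * (M c j * v j))"
      by (subst sum.swap) (intro sum.cong refl sum.swap)
    also have "\<dots> = (\<Sum>a<r. \<Sum>c<r. \<Sum>i<r'. \<Sum>j<r'. M a i * v i * G a c * (M c j * v j))"
      by (intro sum.cong refl sum.swap)
    also have "\<dots> = ?r"
      unfolding sum_distrib_left sum_distrib_right by (intro sum.cong refl sum.swap)
    finally show ?thesis .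
  qed
  have "sym_mat r' G'"
    unfolding sym_mat_def G'_def
  proof (intro allI impI)
    fix i j
    show "(\<Sum>a<r. \<Sum>c<r. M a i * G a c * M c j) = (\<Sum>a<r. \<Sum>c<r. M a j * G a c * M c i)"
      using G(1) by (subst sum.swap) (intro sum.cong refl, simp add: psd_mat_def sym_mat_def)
  qed
  then have "psd_mat r' G'"
    using G(1) by (simp add: psd_mat_def G')
  moreover have "F (h x) = gram_form r' b' G' x" if "x \<in> K'" for x
  proof -
    have "F (h x) = gram_form r b G (h x)" using G(2) K[OF that] by blast
    also have "\<dots> = (\<Sum>a<r. \<Sum>c<r. (\<Sum>i<r'. M a i * b' i x) * G a c * (\<Sum>j<r'. M c j * b' j x))"
      unfolding gram_form_def by (intro sum.cong refl) (simp add: M)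
    also have "\<dots> = gram_form r' b' G' x"
      unfolding gram_form_def G' ..
    finally show ?thesis .
  qed
  ultimately show ?thesis unfolding gram_rep_def by blast
qed

text \<open>Order and repetitions are left open: by \<open>gram_rep_compose\<close> only the span of
  the entries matters.\<close>

definition monomial_list :: "nat \<Rightarrow> ('v::euclidean_space \<Rightarrow> real) list"
  where "monomial_list m = (SOME l. set l = monomials m)"

lemma set_monomial_list: "set (monomial_list m) = monomials m"
  unfolding monomial_list_def using someI_ex[OF finite_list[OF finite_monomials]] .

text \<open>\<open>m\<close> bounds the degree of the polynomials that are squared, not that of the
  sum.\<close>

definition sos_degree :: "'v::euclidean_space set \<Rightarrow> nat \<Rightarrow> ('v \<Rightarrow> real) \<Rightarrow> bool"
  where "sos_degree K m = gram_rep K (length (monomial_list m :: ('v \<Rightarrow> real) list)) ((!) (monomial_list m))"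

lemma nth_image_monomial_list:
  fixes m :: nat
  defines "l \<equiv> monomial_list m :: ('v::euclidean_space \<Rightarrow> real) list"
  shows "(!) l ` {..<length l} = monomials m"
proof -
  have "(!) l ` {..<length l} = set (map ((!) l) [0..<length l])"
    by (simp only: set_map set_upt atLeast0LessThan)
  then show ?thesis by (simp only: map_nth l_def set_monomial_list)
qed

lemma sos_degree_compose:
  assumes "sos_degree K m F" "\<And>x. x \<in> K' \<Longrightarrow> h x \<in> K"
    and "\<And>q. q \<in> monomials m \<Longrightarrow> fspan (monomials n) (\<lambda>x. q (h x))"
  shows "sos_degree K' n (\<lambda>x. F (h x))"
  unfolding sos_degree_def
  by (rule gram_rep_compose[OF assms(1)[unfolded sos_degree_def] assms(2)])
    (simp_all only: nth_image_monomial_list assms(3))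

lemma sos_degree_mono:
  assumes "sos_degree K m F" "m \<le> n"
  shows "sos_degree K n F"
  by (rule sos_degree_compose[OF assms(1), where h = "\<lambda>x. x"])
    (use monomials_mono[OF assms(2)] in \<open>auto intro: fspan_base\<close>)

lemma sos_degree_square:
  fixes p :: "'v::euclidean_space \<Rightarrow> real"
  assumes "fspan (monomials m) p" "\<And>x. x \<in> K \<Longrightarrow> F x = (p x)\<^sup>2"
  shows "sos_degree K m F"
proof -
  let ?l = "monomial_list m :: ('v \<Rightarrow> real) list"
  obtain c where "\<And>x. p x = (\<Sum>a<length ?l. c a * (?l ! a) x)"
    using fspan_coeffs[of "(!) ?l" "length ?l" p] assms(1)
    unfolding nth_image_monomial_list by blast
  then show ?thesis
    unfolding sos_degree_def using assms(2) by (intro gram_rep_square[where c = c]) simp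
qed

text \<open>The degree that \<open>sos_on\<close> leaves out is recovered as a maximum over the
  finitely many squares.\<close>

lemma sos_on_sos_degree:
  assumes "sos_on K F"
  shows "\<exists>m. sos_degree K m F"
  using assms
proof (induction rule: sos_on.induct)
  case (square p F)
  then show ?case using polynomial_fspan_monomials_degree[of p] sos_degree_square by blast
next
  case (add F G H)
  then obtain m n where "sos_degree K m F" "sos_degree K n G" by blast
  then have "sos_degree K (max m n) F" "sos_degree K (max m n) G"
    by (auto intro: sos_degree_mono)
  then have "sos_degree K (max m n) (\<lambda>x. F x + G x)"
    unfolding sos_degree_def by (rule gram_rep_add)
  then show ?case using add.hyps(3) unfolding sos_degree_def gram_rep_def by auto
qed

section \<open>Linear matrix inequalities\<close>

text \<open>A spectrahedral shadow is described by one matrix inequality; the diagonal tail lets it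
  carry scalar inequalities besides the condition on \<open>P\<close>.\<close>

definition block_diag :: "nat \<Rightarrow> (nat \<Rightarrow> nat \<Rightarrow> real) \<Rightarrow> (nat \<Rightarrow> real) \<Rightarrow> nat \<Rightarrow> nat \<Rightarrow> real"
  where "block_diag r P D a b =
    (if a < r \<and> b < r then P a b else if r \<le> a \<and> a = b then D (a - r) else 0)"

lemma sym_mat_block_diag: "sym_mat r P \<Longrightarrow> sym_mat d (block_diag r P D)"
  by (auto simp: sym_mat_def block_diag_def)

lemma sum_lessThan_add: "(\<Sum>a<r + q. f a) = (\<Sum>a<r. f a) + (\<Sum>i<q. f (r + i))"
  for f :: "nat \<Rightarrow> real"
  by (induction q) (auto simp: add.assoc)

lemma block_diag_form:
  "(\<Sum>a<r + q. \<Sum>b<r + q. v a * block_diag r P D a b * v b)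
    = (\<Sum>a<r. \<Sum>b<r. v a * P a b * v b) + (\<Sum>i<q. D i * (v (r + i))\<^sup>2)"
proof -
  have "(\<Sum>b<r + q. v a * block_diag r P D a b * v b) = (\<Sum>b<r. v a * P a b * v b)" if "a < r" for a
    using that by (simp add: sum_lessThan_add block_diag_def)
  moreover have "(\<Sum>b<r + q. v (r + i) * block_diag r P D (r + i) b * v b) = D i * (v (r + i))\<^sup>2"
    if "i < q" for i
  proof -
    have "(\<Sum>b<r + q. v (r + i) * block_diag r P D (r + i) b * v b)
        = (\<Sum>j<q. v (r + i) * block_diag r P D (r + i) (r + j) * v (r + j))"
      by (simp add: sum_lessThan_add block_diag_def)
    also have "\<dots> = (\<Sum>j<q. if j = i then D i * (v (r + i))\<^sup>2 else 0)"
      by (intro sum.cong) (auto simp: block_diag_def power2_eq_square)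
    finally have "(\<Sum>b<r + q. v (r + i) * block_diag r P D (r + i) b * v b)
        = (\<Sum>j<q. if j = i then D i * (v (r + i))\<^sup>2 else 0)" .
    then show ?thesis using that by simp
  qed
  ultimately show ?thesis by (simp add: sum_lessThan_add[where f = "\<lambda>a. \<Sum>b<r + q. v a * block_diag r P D a b * v b"])
qed

lemma psd_mat_block_diag:
  "psd_mat (r + q) (block_diag r P D) \<longleftrightarrow> psd_mat r P \<and> (\<forall>i<q. D i \<ge> 0)"
proof
  assume L: "psd_mat (r + q) (block_diag r P D)"
  then have form: "(\<Sum>a<r. \<Sum>b<r. v a * P a b * v b) + (\<Sum>i<q. D i * (v (r + i))\<^sup>2) \<ge> 0" for v
    by (simp add: psd_mat_def block_diag_form)
  have "(\<Sum>a<r. \<Sum>b<r. v a * P a b * v b) \<ge> 0" for v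
    using form[of "\<lambda>a. if a < r then v a else 0"] by simp
  moreover have "sym_mat r P"
    unfolding sym_mat_def
  proof (intro allI impI)
    fix a b assume "a < r" "b < r"
    moreover from this L have "block_diag r P D a b = block_diag r P D b a"
      by (simp add: psd_mat_def sym_mat_def)
    ultimately show "P a b = P b a" by (simp add: block_diag_def)
  qed
  moreover have "D i \<ge> 0" if "i < q" for i
  proof -
    let ?v = "\<lambda>a. if a = r + i then 1 else 0 :: real"
    have "(\<Sum>a<r. \<Sum>b<r. ?v a * P a b * ?v b) = 0" by simp
    moreover have "(\<Sum>j<q. D j * (?v (r + j))\<^sup>2) = (\<Sum>j<q. if j = i then D j else 0)"
      by (intro sum.cong) auto
    ultimately show ?thesis using form[of ?v] that by simp
  qed
  ultimately show "psd_mat r P \<and> (\<forall>i<q. D i \<ge> 0)" unfolding psd_mat_def by blast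
next
  assume R: "psd_mat r P \<and> (\<forall>i<q. D i \<ge> 0)"
  then have "sym_mat (r + q) (block_diag r P D)"
    by (intro sym_mat_block_diag) (simp add: psd_mat_def)
  moreover have "(\<Sum>a<r. \<Sum>b<r. v a * P a b * v b) + (\<Sum>i<q. D i * (v (r + i))\<^sup>2) \<ge> 0" for v
    using R by (intro add_nonneg_nonneg sum_nonneg[of "{..<q}"]) (simp_all add: psd_mat_def)
  ultimately show "psd_mat (r + q) (block_diag r P D)"
    by (simp add: psd_mat_def block_diag_form)
qed

lemma sum_delta_delta:
  fixes h :: "nat \<Rightarrow> nat \<Rightarrow> real"
  assumes "a0 < r" "c0 < r"
  shows "(\<Sum>a<r. \<Sum>c<r. if a = a0 then if c = c0 then h a c else 0 else 0) = h a0 c0"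
proof -
  have "(\<Sum>a<r. \<Sum>c<r. if a = a0 then if c = c0 then h a c else 0 else 0)
      = (\<Sum>a<r. if a = a0 then h a c0 else 0)"
    using assms by (intro sum.cong refl) auto
  then show ?thesis using assms by simp
qed

text \<open>The identity on \<open>K\<close> amounts to finitely many affine equations in \<open>x\<close> and the Gram matrix,
  each of which is encoded by two diagonal entries of opposite sign.\<close>

lemma spectrahedral_shadow_gram_rep:
  fixes f :: "'v \<Rightarrow> real"
  shows "spectrahedral_shadow N {x \<in> rspace N. gram_rep K r b (\<lambda>z. f z + (\<Sum>i<N. x i * g i z))}"
proof -
  let ?bb = "\<lambda>(a, c) z. b a z * b c z"
  \<comment> \<open>This span contains the residual of the identity for every \<open>x\<close> and
    every Gram matrix at once, so the sample points depend on neither.\<close>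
  let ?Q = "{f} \<union> g ` {..<N} \<union> ?bb ` ({..<r} \<times> {..<r})"
  obtain S where S: "finite S" "S \<subseteq> K"
    "\<And>F. fspan ?Q F \<Longrightarrow> (\<forall>s\<in>S. F s = 0) \<Longrightarrow> (\<forall>x\<in>K. F x = 0)"
    using fspan_finite_sampling[of ?Q K] by blast
  obtain l where l: "set l = S" using finite_list[OF S(1)] by blast
  define p where "p = length l"
  define t where "t i = (if i < p then l ! i else l ! (i - p))" for i
  define sg :: "nat \<Rightarrow> real" where "sg i = (if i < p then 1 else -1)" for i
  define m where "m = card ({..<r} \<times> {..<r})"
  obtain e where e: "bij_betw e {..<m} ({..<r} \<times> {..<r})"
    using ex_bij_betw_nat_finite[of "{..<r} \<times> {..<r}"] by (auto simp: m_def atLeast0LessThan)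
  have e_sum: "(\<Sum>j<m. h (e j)) = (\<Sum>a<r. \<Sum>c<r. h (a, c))" for h :: "nat \<times> nat \<Rightarrow> real"
    using sum.reindex_bij_betw[OF e, of h] by (simp add: sum.cartesian_product)
  \<comment> \<open>All \<open>r * r\<close> matrix positions are unknowns. Averaging a matrix unit
    with its transpose makes the coefficient matrix symmetric and leaves the product of the two
    basis functions unchanged.\<close>
  define E :: "nat \<Rightarrow> nat \<Rightarrow> nat \<Rightarrow> real"
    where "E j a c = (if e j = (a, c) then 1 / 2 else 0) + (if e j = (c, a) then 1 / 2 else 0)" for j a c
  have E_sym: "E j a c = E j c a" for j a c by (simp add: E_def)
  have E_form: "gram_form r b (E j) z = ?bb (e j) z" if "j < m" for j z
  proof -
    obtain a0 c0 where ac: "e j = (a0, c0)" "a0 < r" "c0 < r"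
      using bij_betwE[OF e] \<open>j < m\<close> by fastforce
    have "gram_form r b (E j) z
        = (\<Sum>a<r. \<Sum>c<r. (if a = a0 then if c = c0 then b a z * b c z / 2 else 0 else 0))
          + (\<Sum>a<r. \<Sum>c<r. (if a = c0 then if c = a0 then b a z * b c z / 2 else 0 else 0))"
      unfolding gram_form_def sum.distrib[symmetric]
      by (intro sum.cong refl) (auto simp: E_def ac)
    also have "\<dots> = b a0 z * b c0 z"
      unfolding sum_delta_delta[OF ac(2,3)] sum_delta_delta[OF ac(3,2)] by simp
    finally show ?thesis by (simp add: ac)
  qed
  have gram_E: "gram_form r b (\<lambda>a c. \<Sum>j<m. y j * E j a c) z = (\<Sum>j<m. y j * ?bb (e j) z)" for y z
  proof -
    have "gram_form r b (\<lambda>a c. \<Sum>j<m. y j * E j a c) z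
        = (\<Sum>a<r. \<Sum>c<r. \<Sum>j<m. y j * (b a z * E j a c * b c z))"
      unfolding gram_form_def sum_distrib_left sum_distrib_right
      by (intro sum.cong refl) simp
    also have "\<dots> = (\<Sum>a<r. \<Sum>j<m. \<Sum>c<r. y j * (b a z * E j a c * b c z))"
      by (intro sum.cong refl sum.swap)
    also have "\<dots> = (\<Sum>j<m. \<Sum>a<r. \<Sum>c<r. y j * (b a z * E j a c * b c z))"
      by (rule sum.swap)
    also have "\<dots> = (\<Sum>j<m. y j * gram_form r b (E j) z)"
      unfolding gram_form_def sum_distrib_left ..
    also have "\<dots> = (\<Sum>j<m. y j * ?bb (e j) z)"
      by (intro sum.cong refl) (simp add: E_form)
    finally show ?thesis .
  qed
  define A where "A = block_diag r (\<lambda>_ _. 0) (\<lambda>i. sg i * f (t i))"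
  define B where "B n = block_diag r (\<lambda>_ _. 0) (\<lambda>i. sg i * g n (t i))" for n
  define C where "C j = block_diag r (E j) (\<lambda>i. - sg i * ?bb (e j) (t i))" for j
  define L where "L x y z = f z + (\<Sum>n<N. x n * g n z) - (\<Sum>j<m. y j * ?bb (e j) z)" for x y z
  have M: "(\<lambda>a c. A a c + (\<Sum>n<N. x n * B n a c) + (\<Sum>j<m. y j * C j a c))
      = block_diag r (\<lambda>a c. \<Sum>j<m. y j * E j a c) (\<lambda>i. sg i * L x y (t i))" for x y
  proof (intro ext)
    fix a c
    consider "a < r" "c < r" | "r \<le> a" "a = c" | "\<not> (a < r \<and> c < r)" "\<not> (r \<le> a \<and> a = c)" by blast
    then show "A a c + (\<Sum>n<N. x n * B n a c) + (\<Sum>j<m. y j * C j a c)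
        = block_diag r (\<lambda>a c. \<Sum>j<m. y j * E j a c) (\<lambda>i. sg i * L x y (t i)) a c"
    proof cases
      case 1
      then show ?thesis by (simp add: A_def B_def C_def block_diag_def)
    next
      case 2
      then show ?thesis
        by (simp add: A_def B_def C_def block_diag_def L_def algebra_simps sum_distrib_left sum_negf)
    next
      case 3
      then have "block_diag r P D a c = 0" for P D by (simp only: block_diag_def if_False)
      then show ?thesis by (simp add: A_def B_def C_def)
    qed
  qed
  have psd: "psd_mat (r + 2 * p) (\<lambda>a c. A a c + (\<Sum>n<N. x n * B n a c) + (\<Sum>j<m. y j * C j a c))
      \<longleftrightarrow> psd_mat r (\<lambda>a c. \<Sum>j<m. y j * E j a c) \<and> (\<forall>s\<in>S. L x y s = 0)" for x y
  proof -
    have "(\<forall>i<2 * p. sg i * L x y (t i) \<ge> 0) \<longleftrightarrow> (\<forall>i<p. L x y (l ! i) = 0)"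
    proof safe
      fix i assume *: "\<forall>i<2 * p. sg i * L x y (t i) \<ge> 0" and i: "i < p"
      have "L x y (l ! i) \<ge> 0" using *[rule_format, of i] i by (simp add: sg_def t_def)
      moreover have "L x y (l ! i) \<le> 0" using *[rule_format, of "p + i"] i by (simp add: sg_def t_def)
      ultimately show "L x y (l ! i) = 0" by linarith
    next
      fix i assume "\<forall>i<p. L x y (l ! i) = 0" "i < 2 * p"
      then show "sg i * L x y (t i) \<ge> 0" by (simp add: sg_def t_def)
    qed
    also have "\<dots> \<longleftrightarrow> (\<forall>s\<in>S. L x y s = 0)"
      unfolding l[symmetric] p_def by (rule all_set_conv_all_nth[symmetric])
    finally show ?thesis unfolding M psd_mat_block_diag by simp
  qed
  have LK: "(\<forall>s\<in>S. L x y s = 0) \<longleftrightarrow> (\<forall>z\<in>K. L x y z = 0)" for x y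
  proof
    have "fspan ?Q f" by (rule fspan_base) simp
    moreover have "fspan ?Q (\<lambda>z. x n * g n z)" if "n \<in> {..<N}" for n
      using that by (intro fspan_scale fspan_base) simp
    moreover have "fspan ?Q (\<lambda>z. (- y j) * ?bb (e j) z)" if "j \<in> {..<m}" for j
    proof -
      have "?bb (e j) \<in> ?bb ` ({..<r} \<times> {..<r})"
        using bij_betwE[OF e] that by (intro imageI) blast
      then show ?thesis by (intro fspan_scale fspan_base UnI2)
    qed
    ultimately have "fspan ?Q (\<lambda>z. f z + (\<Sum>n<N. x n * g n z) + (\<Sum>j<m. (- y j) * ?bb (e j) z))"
      by (intro fspan_add fspan_sum)
    then have "fspan ?Q (L x y)" by (simp add: L_def[abs_def] sum_negf)
    then show "\<forall>s\<in>S. L x y s = 0 \<Longrightarrow> \<forall>z\<in>K. L x y z = 0" by (rule S(3))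
  qed (use S(2) in auto)
  show ?thesis
    unfolding spectrahedral_shadow_def
  proof (intro exI conjI allI impI)
    show "sym_mat (r + 2 * p) A" "sym_mat (r + 2 * p) (B i)" for i
      unfolding A_def B_def by (rule sym_mat_block_diag, simp add: sym_mat_def)+
    show "sym_mat (r + 2 * p) (C j)" for j
      unfolding C_def by (rule sym_mat_block_diag) (use E_sym in \<open>auto simp: sym_mat_def\<close>)
    have "gram_rep K r b (\<lambda>z. f z + (\<Sum>i<N. x i * g i z)) \<longleftrightarrow>
        (\<exists>y\<in>rspace m. psd_mat r (\<lambda>a c. \<Sum>j<m. y j * E j a c) \<and> (\<forall>z\<in>K. L x y z = 0))" for x
    proof
      assume "gram_rep K r b (\<lambda>z. f z + (\<Sum>i<N. x i * g i z))"
      then obtain G where G: "psd_mat r G" "\<And>z. z \<in> K \<Longrightarrow> f z + (\<Sum>i<N. x i * g i z) = gram_form r b G z"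
        unfolding gram_rep_def by blast
      \<comment> \<open>The entries of \<open>G\<close> itself: as \<open>G\<close> is symmetric,
        the averaging in \<open>E\<close> gives \<open>G\<close> back.\<close>
      define y where "y j = (if j < m then case_prod G (e j) else 0)" for j
      have yE: "(\<Sum>j<m. y j * E j a c) = G a c" if "a < r" "c < r" for a c
      proof -
        have "(\<Sum>j<m. y j * E j a c) = (\<Sum>j<m. case_prod G (e j) *
            ((if e j = (a, c) then 1 / 2 else 0) + (if e j = (c, a) then 1 / 2 else 0)))"
          by (intro sum.cong) (auto simp: y_def E_def)
        also have "\<dots> = (\<Sum>a'<r. \<Sum>c'<r. G a' c' *
            ((if (a', c') = (a, c) then 1 / 2 else 0) + (if (a', c') = (c, a) then 1 / 2 else 0)))"
          using e_sum[of "\<lambda>ac. case_prod G ac *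
            ((if ac = (a, c) then 1 / 2 else 0) + (if ac = (c, a) then 1 / 2 else 0))"] by simp
        also have "\<dots> = (\<Sum>a'<r. \<Sum>c'<r. if a' = a then if c' = c then G a' c' / 2 else 0 else 0)
            + (\<Sum>a'<r. \<Sum>c'<r. if a' = c then if c' = a then G a' c' / 2 else 0 else 0)"
          unfolding sum.distrib[symmetric] by (intro sum.cong refl) auto
        also have "\<dots> = G a c / 2 + G c a / 2"
          unfolding sum_delta_delta[OF that] sum_delta_delta[OF that(2,1)] ..
        also have "\<dots> = G a c"
          using G(1) that by (auto simp: psd_mat_def sym_mat_def)
        finally show ?thesis .
      qed
      have eq: "gram_form r b (\<lambda>a c. \<Sum>j<m. y j * E j a c) z = gram_form r b G z" for z
        unfolding gram_form_def by (intro sum.cong refl) (simp add: yE)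
      have "psd_mat r (\<lambda>a c. \<Sum>j<m. y j * E j a c)"
      proof -
        have "(\<Sum>a<r. \<Sum>c<r. v a * (\<Sum>j<m. y j * E j a c) * v c) = (\<Sum>a<r. \<Sum>c<r. v a * G a c * v c)" for v
          by (intro sum.cong refl) (simp add: yE)
        then show ?thesis
          using G(1) yE unfolding psd_mat_def sym_mat_def by simp
      qed
      moreover have "\<forall>z\<in>K. L x y z = 0"
        using G(2) eq unfolding L_def gram_E by simp
      moreover have "y \<in> rspace m" by (simp add: rspace_def y_def)
      ultimately show "\<exists>y\<in>rspace m. psd_mat r (\<lambda>a c. \<Sum>j<m. y j * E j a c) \<and> (\<forall>z\<in>K. L x y z = 0)"
        by blast
    next
      assume "\<exists>y\<in>rspace m. psd_mat r (\<lambda>a c. \<Sum>j<m. y j * E j a c) \<and> (\<forall>z\<in>K. L x y z = 0)"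
      then obtain y where y: "psd_mat r (\<lambda>a c. \<Sum>j<m. y j * E j a c)" "\<And>z. z \<in> K \<Longrightarrow> L x y z = 0"
        by blast
      then have "f z + (\<Sum>i<N. x i * g i z) = gram_form r b (\<lambda>a c. \<Sum>j<m. y j * E j a c) z"
        if "z \<in> K" for z
        using y(2)[OF that] unfolding gram_E by (simp add: L_def)
      with y(1) show "gram_rep K r b (\<lambda>z. f z + (\<Sum>i<N. x i * g i z))"
        unfolding gram_rep_def by blast
    qed
    then show "{x \<in> rspace N. gram_rep K r b (\<lambda>z. f z + (\<Sum>i<N. x i * g i z))}
      = {x \<in> rspace N. \<exists>y\<in>rspace m. psd_mat (r + 2 * p)
          (\<lambda>a c. A a c + (\<Sum>n<N. x n * B n a c) + (\<Sum>j<m. y j * C j a c))}"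
      unfolding psd LK by simp
  qed
qed

section \<open>Coordinates on finite-dimensional subspaces\<close>

text \<open>Coordinates with respect to a basis. Finite dimension enters as finiteness of
  independent subsets, which \<open>independent_bivector_endo_finite\<close> supplies for
  operators.\<close>

lemma coord_iso_subspace:
  fixes V :: "'v::real_vector set"
  assumes V: "subspace V" and fin: "\<And>B. B \<subseteq> V \<Longrightarrow> independent B \<Longrightarrow> finite B"
  shows "\<exists>N v. coord_iso N (\<lambda>x. \<Sum>i<N. x i *\<^sub>R v i) V"
proof -
  obtain B where B: "B \<subseteq> V" "independent B" "V \<subseteq> span B"
    using maximal_independent_subset[of V] by blast
  then have "finite B" "span B = V" using fin V by (auto dest: span_subspace)
  obtain v :: "nat \<Rightarrow> 'v" where v: "bij_betw v {..<card B} B"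
    using ex_bij_betw_nat_finite[OF \<open>finite B\<close>] by (auto simp: atLeast0LessThan)
  let ?N = "card B" and ?\<phi> = "\<lambda>x. \<Sum>i<card B. x i *\<^sub>R v i"
  have reindex: "(\<Sum>i<?N. u (v i) *\<^sub>R v i) = (\<Sum>w\<in>B. u w *\<^sub>R w)" for u
    using sum.reindex_bij_betw[OF v, of "\<lambda>w. u w *\<^sub>R w"] by simp
  have "bij_betw ?\<phi> (rspace ?N) V"
  proof (rule bij_betwI')
    fix x y :: "nat \<Rightarrow> real" assume xy: "x \<in> rspace ?N" "y \<in> rspace ?N"
    show "(?\<phi> x = ?\<phi> y) = (x = y)"
    proof
      assume eq: "?\<phi> x = ?\<phi> y"
      define u where "u w = (x - y) (inv_into {..<?N} v w)" for w
      have uv: "u (v i) = x i - y i" if "i < ?N" for i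
        using bij_betw_inv_into_left[OF v, of i] that by (simp add: u_def)
      have "(\<Sum>w\<in>B. u w *\<^sub>R w) = (\<Sum>i<?N. (x i - y i) *\<^sub>R v i)"
        unfolding reindex[symmetric] by (intro sum.cong refl) (simp add: uv)
      also have "\<dots> = 0" using eq by (simp add: scaleR_diff_left sum_subtractf)
      finally have "\<forall>w\<in>B. u w = 0"
        using independentD[OF B(2) \<open>finite B\<close> subset_refl] by blast
      then have "x i = y i" if "i < ?N" for i
        using uv[OF that] bij_betwE[OF v] that by force
      then show "x = y" using xy by (auto simp: rspace_def fun_eq_iff) (metis not_le)
    qed simp
  next
    fix x show "?\<phi> x \<in> V"
      using bij_betwE[OF v] B(1) V by (intro subspace_sum subspace_scale) auto
  next
    fix w assume "w \<in> V"
    then obtain u where u: "w = (\<Sum>w\<in>B. u w *\<^sub>R w)"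
      using \<open>span B = V\<close> span_finite[OF \<open>finite B\<close>] by auto
    show "\<exists>x\<in>rspace ?N. w = ?\<phi> x"
      by (rule bexI[of _ "\<lambda>i. if i < ?N then u (v i) else 0"])
        (simp_all add: rspace_def u flip: reindex)
  qed
  then have "coord_iso ?N ?\<phi> V"
    unfolding coord_iso_def by (auto simp: scaleR_add_left sum.distrib scaleR_sum_right)
  then show ?thesis by blast
qed

lemma coord_iso_image_Collect:
  assumes "coord_iso N \<phi> V"
  shows "\<phi> ` {x \<in> rspace N. P (\<phi> x)} = {v \<in> V. P v}"
proof -
  have "\<phi> ` rspace N = V" using assms by (simp add: coord_iso_def bij_betw_def)
  then show ?thesis by blast
qed

section \<open>Integration over the unit ball\<close>

lemma nn_integral_lborel_shift:
  fixes h :: "'a::euclidean_space \<Rightarrow> ennreal"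
  assumes "h \<in> borel_measurable borel"
  shows "(\<integral>\<^sup>+ x. h (x + c) \<partial>lborel) = (\<integral>\<^sup>+ x. h x \<partial>lborel)"
proof -
  have "(\<integral>\<^sup>+ x. h x \<partial>lborel) = (\<integral>\<^sup>+ x. h x \<partial>(distr lborel borel ((+) c)))"
    by (simp add: lborel_distr_plus)
  also have "\<dots> = (\<integral>\<^sup>+ x. h (c + x) \<partial>lborel)"
    using assms by (subst nn_integral_distr) simp_all
  finally show ?thesis by (simp add: add.commute)
qed

text \<open>Weil's argument: a translation invariant measure is determined by its value on the unit ball,
  which is fixed by \<open>f\<close>.\<close>

lemma lborel_distr_orthogonal_transformation:
  fixes f :: "'a::euclidean_space \<Rightarrow> 'a"
  assumes f: "orthogonal_transformation f"
  shows "distr lborel borel f = lborel"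
proof (rule measure_eqI)
  let ?g = "inv f" and ?B = "ball (0 :: 'a) 1"
  have lin: "linear f" using f by (simp add: orthogonal_transformation_def)
  have fg: "f (?g y) = y" for y
    using orthogonal_transformation_surj[OF f] by (simp add: surj_f_inv_f)
  have cont: "continuous_on UNIV f" "continuous_on UNIV ?g"
    using lin orthogonal_transformation_inv[OF f]
    by (simp_all add: linear_continuous_on linear_conv_bounded_linear orthogonal_transformation_def)
  have [measurable]: "f \<in> borel_measurable borel" "?g \<in> borel_measurable borel"
    using cont by (auto intro: borel_measurable_continuous_onI)
  fix A assume "A \<in> sets (distr lborel borel f)"
  then have [measurable]: "A \<in> sets borel" by simp
  let ?A = "indicator A :: 'a \<Rightarrow> ennreal" and ?I = "indicator ?B :: 'a \<Rightarrow> ennreal"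
  have [measurable]: "?A \<in> borel_measurable borel" "?I \<in> borel_measurable borel"
    by (intro borel_measurable_indicator; simp)+
  have "emeasure (distr lborel borel f) A * emeasure lborel ?B
      = (\<integral>\<^sup>+ y. ?I y * (\<integral>\<^sup>+ x. ?A (f x) \<partial>lborel) \<partial>lborel)"
  proof -
    have "emeasure (distr lborel borel f) A = (\<integral>\<^sup>+ x. ?A x \<partial>(distr lborel borel f))"
      by simp
    also have "\<dots> = (\<integral>\<^sup>+ x. ?A (f x) \<partial>lborel)"
      by (subst nn_integral_distr) simp_all
    finally show ?thesis
      by (subst nn_integral_multc) (simp_all add: mult.commute)
  qed
  \<comment> \<open>For fixed \<open>y\<close>, translating \<open>x\<close> by \<open>?g y\<close>
    turns \<open>f x\<close> into \<open>f x + y\<close>. After exchanging the integrals,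
    translating \<open>y\<close> by \<open>- f x\<close> moves the shift from \<open>A\<close> to
    the ball.\<close>
  also have "\<dots> = (\<integral>\<^sup>+ y. (\<integral>\<^sup>+ x. ?I y * ?A (f x + y) \<partial>lborel) \<partial>lborel)"
  proof (rule nn_integral_cong)
    fix y
    have "(\<integral>\<^sup>+ x. ?A (f x) \<partial>lborel) = (\<integral>\<^sup>+ x. ?A (f (x + ?g y)) \<partial>lborel)"
      by (rule nn_integral_lborel_shift[symmetric]) measurable
    then show "?I y * (\<integral>\<^sup>+ x. ?A (f x) \<partial>lborel) = (\<integral>\<^sup>+ x. ?I y * ?A (f x + y) \<partial>lborel)"
      by (subst nn_integral_cmult) (simp_all add: linear_add[OF lin] fg)
  qed
  also have "\<dots> = (\<integral>\<^sup>+ x. (\<integral>\<^sup>+ y. ?I y * ?A (f x + y) \<partial>lborel) \<partial>lborel)"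
    by (rule lborel_pair.Fubini') (measurable; simp)
  also have "\<dots> = (\<integral>\<^sup>+ x. (\<integral>\<^sup>+ y. ?I (y - f x) * ?A y \<partial>lborel) \<partial>lborel)"
  proof (rule nn_integral_cong)
    fix x
    show "(\<integral>\<^sup>+ y. ?I y * ?A (f x + y) \<partial>lborel) = (\<integral>\<^sup>+ y. ?I (y - f x) * ?A y \<partial>lborel)"
      using nn_integral_lborel_shift[of "\<lambda>y. ?I y * ?A (f x + y)" "- f x"] by simp
  qed
  also have "\<dots> = (\<integral>\<^sup>+ y. (\<integral>\<^sup>+ x. ?I (y - f x) * ?A y \<partial>lborel) \<partial>lborel)"
    by (rule lborel_pair.Fubini'[symmetric]) (measurable; simp)
  \<comment> \<open>Here the isometry enters: |y - f x| = |x - ?g y|, so the integral over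
    \<open>x\<close> is the volume of a translated unit ball.\<close>
  also have "\<dots> = (\<integral>\<^sup>+ y. ?A y * emeasure lborel ?B \<partial>lborel)"
  proof (rule nn_integral_cong)
    fix y
    have "?I (y - f x) = ?I (x + - ?g y)" for x
    proof -
      have "norm (y - f x) = norm (f (?g y - x))" by (simp add: linear_diff[OF lin] fg)
      also have "\<dots> = norm (x - ?g y)" by (simp add: orthogonal_transformation_norm[OF f] norm_minus_commute)
      finally show ?thesis by (simp add: indicator_def)
    qed
    then have "(\<integral>\<^sup>+ x. ?I (y - f x) \<partial>lborel) = (\<integral>\<^sup>+ x. ?I (x + - ?g y) \<partial>lborel)" by simp
    also have "\<dots> = (\<integral>\<^sup>+ x. ?I x \<partial>lborel)"
      by (rule nn_integral_lborel_shift) simp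
    finally show "(\<integral>\<^sup>+ x. ?I (y - f x) * ?A y \<partial>lborel) = ?A y * emeasure lborel ?B"
      by (subst nn_integral_multc) (simp_all add: mult.commute)
  qed
  also have "\<dots> = emeasure lborel A * emeasure lborel ?B"
    by (subst nn_integral_multc) simp_all
  finally have eq: "emeasure (distr lborel borel f) A * emeasure lborel ?B
      = emeasure lborel A * emeasure lborel ?B" .
  have "emeasure lborel ?B < \<infinity>" by (rule emeasure_lborel_ball_finite)
  moreover have "emeasure lborel ?B \<noteq> 0"
    using content_ball_pos[of 1 "0 :: 'a"] by (auto simp: measure_def)
  ultimately show "emeasure (distr lborel borel f) A = emeasure lborel A"
    using eq by (auto simp: mult.commute[of _ "emeasure lborel ?B"] ennreal_mult_cancel_left)
qed simp

section \<open>Integrals over the closed unit ball\<close>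

definition ball_integral :: "('v::euclidean_space \<Rightarrow> real) \<Rightarrow> real"
  where "ball_integral F = (\<integral>z. indicator (cball 0 1) z *\<^sub>R F z \<partial>lborel)"

lemma integrable_ball:
  fixes F :: "'v::euclidean_space \<Rightarrow> real"
  assumes "continuous_on UNIV F"
  shows "integrable lborel (\<lambda>z. indicator (cball 0 1) z *\<^sub>R F z)"
  using assms by (intro borel_integrable_compact compact_cball) (auto intro: continuous_on_subset)

lemma ball_integral_add:
  assumes "continuous_on UNIV F" "continuous_on UNIV G"
  shows "ball_integral (\<lambda>z. F z + G z) = ball_integral F + ball_integral G"
  unfolding ball_integral_def
  using integrable_ball[OF assms(1)] integrable_ball[OF assms(2)] by (simp add: distrib_left)

lemma ball_integral_cmult: "ball_integral (\<lambda>z. c * F z) = c * ball_integral F"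
  unfolding ball_integral_def by (simp add: mult.left_commute)

lemma ball_integral_sum:
  assumes "\<And>i. i \<in> I \<Longrightarrow> continuous_on UNIV (F i)"
  shows "ball_integral (\<lambda>z. \<Sum>i\<in>I. F i z) = (\<Sum>i\<in>I. ball_integral (F i))"
  using assms
  by (induction I rule: infinite_finite_induct)
    (simp_all add: ball_integral_add continuous_on_sum, simp_all add: ball_integral_def)

lemma ball_integral_mono:
  assumes "continuous_on UNIV F" "continuous_on UNIV G"
    and "\<And>z. z \<in> cball 0 1 \<Longrightarrow> F z \<le> G z"
  shows "ball_integral F \<le> ball_integral G"
  unfolding ball_integral_def
  by (intro integral_mono integrable_ball assms) (auto simp: indicator_def assms(3))

lemma ball_integral_nonneg:
  assumes "\<And>z. z \<in> cball 0 1 \<Longrightarrow> F z \<ge> 0"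
  shows "ball_integral F \<ge> 0"
  unfolding ball_integral_def
  by (intro Bochner_Integration.integral_nonneg) (use assms in \<open>auto simp: indicator_def\<close>)

lemma ball_integral_orthogonal:
  fixes F :: "'v::euclidean_space \<Rightarrow> real" and f :: "'v \<Rightarrow> 'v"
  assumes f: "orthogonal_transformation f" and F: "continuous_on UNIV F"
  shows "ball_integral (\<lambda>z. F (f z)) = ball_integral F"
proof -
  have meas: "f \<in> lborel \<rightarrow>\<^sub>M borel" "(\<lambda>z. indicator (cball 0 1) z *\<^sub>R F z) \<in> borel_measurable borel"
    using f borel_measurable_integrable[OF integrable_ball[OF F]]
    by (auto intro!: borel_measurable_continuous_onI linear_continuous_on
        simp: linear_conv_bounded_linear orthogonal_transformation_def)
  have "ball_integral F
      = (\<integral>z. indicator (cball 0 1) z *\<^sub>R F z \<partial>(distr lborel borel f))"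
    unfolding ball_integral_def lborel_distr_orthogonal_transformation[OF f] ..
  also have "\<dots> = (\<integral>z. indicator (cball 0 1) (f z) *\<^sub>R F (f z) \<partial>lborel)"
    by (rule integral_distr[OF meas])
  also have "\<dots> = ball_integral (\<lambda>z. F (f z))"
    unfolding ball_integral_def
    by (intro Bochner_Integration.integral_cong refl)
      (simp add: indicator_def orthogonal_transformation_norm[OF f])
  finally show ?thesis ..
qed

lemma ball_integral_pos:
  fixes F :: "'v::euclidean_space \<Rightarrow> real"
  assumes F: "continuous_on UNIV F" "\<And>z. F z \<ge> 0" and z0: "z0 \<in> ball 0 1" "F z0 > 0"
  shows "ball_integral F > 0"
proof -
  have "open (ball 0 1 \<inter> {z. F z0 / 2 < F z})"
    by (intro open_Int open_ball open_Collect_less continuous_on_const F(1))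
  moreover have "z0 \<in> ball 0 1 \<inter> {z. F z0 / 2 < F z}" using z0 by simp
  ultimately obtain r where r: "r > 0" "ball z0 r \<subseteq> ball 0 1 \<inter> {z. F z0 / 2 < F z}"
    by (rule openE)
  have "0 < F z0 / 2 * measure lborel (ball z0 r)"
    using z0(2) content_ball_pos[OF r(1)] by simp
  also have "\<dots> = (\<integral>z. indicator (ball z0 r) z * (F z0 / 2) \<partial>lborel)"
    by simp
  also have "\<dots> \<le> ball_integral F"
    unfolding ball_integral_def
  proof (rule integral_mono)
    show "integrable lborel (\<lambda>z. indicator (ball z0 r) z * (F z0 / 2))"
      using emeasure_lborel_ball_finite[of z0 r] by (intro integrable_mult_left integrable_real_indicator) simp_all
    show "indicator (ball z0 r) z * (F z0 / 2) \<le> indicator (cball 0 1) z *\<^sub>R F z" for z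
    proof (cases "z \<in> ball z0 r")
      case True
      then have "z \<in> cball 0 1" "F z0 / 2 < F z" using r(2) by auto
      then show ?thesis using True by simp
    next
      case False
      then show ?thesis using F(2)[of z] by simp
    qed
  qed (rule integrable_ball[OF F(1)])
  finally show ?thesis .
qed

text \<open>Test against polynomials \<open>p\<close> close to the negative part \<open>u\<close> of \<open>F\<close>, for which \<open>F u\<^sup>2 = - u\<^sup>3\<close>.\<close>

lemma nonneg_if_ball_integral_squares_nonneg:
  fixes F :: "'v::euclidean_space \<Rightarrow> real"
  assumes F: "continuous_on UNIV F"
    and sq: "\<And>p. real_polynomial_function p \<Longrightarrow> ball_integral (\<lambda>z. F z * (p z)\<^sup>2) \<ge> 0"
    and z0: "z0 \<in> ball 0 1"
  shows "F z0 \<ge> 0"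
proof (rule ccontr)
  assume neg: "\<not> F z0 \<ge> 0"
  define u where "u z = max 0 (- F z)" for z
  have u: "continuous_on UNIV u"
    unfolding u_def by (intro continuous_on_max continuous_on_const continuous_on_minus F)
  have Fu: "F z * (u z)\<^sup>2 = - ((u z) ^ 3)" for z
    by (auto simp: u_def max_def power2_eq_square power3_eq_cube)
  define c where "c = ball_integral (\<lambda>z. (u z) ^ 3)"
  have c: "c > 0"
    unfolding c_def using neg
    by (intro ball_integral_pos[OF _ _ z0] continuous_on_power u) (auto simp: u_def)
  define V where "V = ball_integral (\<lambda>_ :: 'v. 1)"
  have "V \<ge> 0" unfolding V_def by (intro ball_integral_nonneg) simp
  have "bounded (F ` cball 0 1)"
    by (intro compact_imp_bounded compact_continuous_image continuous_on_subset[OF F]) auto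
  then obtain M where M: "M > 0" "\<And>z. z \<in> cball 0 1 \<Longrightarrow> \<bar>F z\<bar> \<le> M"
    unfolding bounded_pos by (auto simp: image_iff)
  \<comment> \<open>|F p^2 - F u^2| = |F| |p - u| |p + u| is at most M d (2 M + 1), where d \<le> 1
    is used to bound |p + u|. Integrated, the error stays below \<open>c\<close>.\<close>
  define d where "d = min 1 (c / (2 * (M * (2 * M + 1) * (V + 1))))"
  have "M * (2 * M + 1) * (V + 1) > 0"
    using M(1) \<open>V \<ge> 0\<close> by (intro mult_pos_pos) auto
  then have d: "d > 0" "d \<le> 1" "M * (2 * M + 1) * d * (V + 1) < c"
  proof -
    let ?D = "M * (2 * M + 1) * (V + 1)"
    assume D: "?D > 0"
    then show "d > 0" using c by (simp add: d_def)
    show "d \<le> 1" by (simp add: d_def)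
    have "?D * d \<le> ?D * (c / (2 * ?D))"
      using D by (intro mult_left_mono) (simp_all add: d_def)
    also have "\<dots> = c / 2" using D by (simp add: field_simps)
    also have "\<dots> < c" using c by simp
    finally show "M * (2 * M + 1) * d * (V + 1) < c" by (simp add: mult_ac)
  qed
  obtain p where p: "real_polynomial_function p" "\<And>z. z \<in> cball 0 1 \<Longrightarrow> \<bar>u z - p z\<bar> < d"
    using Stone_Weierstrass_real_polynomial_function[OF compact_cball continuous_on_subset[OF u subset_UNIV] d(1)]
    by blast
  have contp: "continuous_on UNIV p"
    using p(1) by (simp add: continuous_on_polymonial_function real_polynomial_function_eq)
  have bound: "F z * (p z)\<^sup>2 \<le> - ((u z) ^ 3) + M * (2 * M + 1) * d * 1" if z: "z \<in> cball 0 1" for z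
  proof -
    have u0: "0 \<le> u z" "u z \<le> M" using M(1) M(2)[OF z] by (auto simp: u_def)
    have pu: "\<bar>p z - u z\<bar> \<le> d" using p(2)[OF z] by simp
    have "\<bar>F z * (p z)\<^sup>2 - F z * (u z)\<^sup>2\<bar> = \<bar>F z\<bar> * (\<bar>p z - u z\<bar> * \<bar>p z + u z\<bar>)"
      by (simp add: power2_eq_square algebra_simps flip: abs_mult)
    also have "\<dots> \<le> M * (d * (2 * M + 1))"
      using u0 pu d M(1) M(2)[OF z] by (intro mult_mono) auto
    finally show ?thesis unfolding Fu by (simp add: algebra_simps)
  qed
  have "0 \<le> ball_integral (\<lambda>z. F z * (p z)\<^sup>2)" by (rule sq[OF p(1)])
  also have "\<dots> \<le> ball_integral (\<lambda>z. (- 1) * (u z) ^ 3 + M * (2 * M + 1) * d * 1)"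
    using bound by (intro ball_integral_mono continuous_intros F contp u) simp
  also have "\<dots> = - c + M * (2 * M + 1) * d * V"
    unfolding c_def V_def
    by (subst ball_integral_add) (simp_all only: ball_integral_cmult, intro continuous_intros u, simp)
  also have "\<dots> \<le> - c + M * (2 * M + 1) * d * (V + 1)"
    using M(1) d(1) by (intro add_left_mono mult_left_mono) auto
  also have "\<dots> < 0" using d(3) by simp
  finally show False by simp
qed

section \<open>The curvature form\<close>

lemma wedge_scaleR_right: "X \<and>\<^sub>b (c *\<^sub>R Y) = c *\<^sub>R (X \<and>\<^sub>b Y)"
  by (metis wedge_swap wedge_scaleR_left scaleR_minus_right)

definition pair_wedge :: "(real^'n) \<times> (real^'n) \<Rightarrow> ('n::finite) bivector"
  where "pair_wedge z = fst z \<and>\<^sub>b snd z"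

text \<open>The factor after \<open>k\<close> makes the form homogeneous of degree four in the pair,
  so its sign may be tested at any scale.\<close>

definition curv_form :: "real \<Rightarrow> ('n::finite) bivector_endo \<Rightarrow> (real^'n) \<times> (real^'n) \<Rightarrow> real"
  where "curv_form k R z = R (pair_wedge z) \<bullet> pair_wedge z - k * (pair_wedge z \<bullet> pair_wedge z)"

lemma pair_wedge_scaleR: "pair_wedge (c *\<^sub>R z) = c\<^sup>2 *\<^sub>R pair_wedge z"
  by (simp add: pair_wedge_def wedge_scaleR_left wedge_scaleR_right power2_eq_square)

lemma curv_form_scaleR: "curv_form k R (c *\<^sub>R z) = c ^ 4 * curv_form k R z"
proof -
  have "c ^ 4 = c\<^sup>2 * c\<^sup>2" by (simp flip: power_add)
  then show ?thesis
    by (simp add: curv_form_def pair_wedge_scaleR blinfun.scaleR_right right_diff_distrib mult_ac)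
qed

text \<open>The factor 1/2 is the one in \<open>bivector_expansion\<close>.\<close>

lemma polynomial_mat_of_pair_wedge:
  fixes i j :: "'n::finite"
  shows "real_polynomial_function (\<lambda>z. mat_of_bivector (pair_wedge z) $ i $ j / 2)"
proof -
  have "real_polynomial_function (\<lambda>z :: (real^'n) \<times> (real^'n). fst z $ i)"
    "real_polynomial_function (\<lambda>z :: (real^'n) \<times> (real^'n). snd z $ i)" for i
    by (intro real_polynomial_function.intros(1) bounded_linear_compose[OF bounded_linear_vec_nth]
        bounded_linear_fst bounded_linear_snd)+
  then have "real_polynomial_function
      (\<lambda>z :: (real^'n) \<times> (real^'n). (fst z $ i * snd z $ j - fst z $ j * snd z $ i) / 2)"
    by (intro real_polynomial_function_divide real_polynomial_function_diff
        real_polynomial_function.intros(4))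
  then show ?thesis by (simp add: pair_wedge_def wedge.rep_eq)
qed

lemma polynomial_linear_pair_wedge:
  fixes L :: "'n::finite bivector \<Rightarrow> real"
  assumes "linear L"
  shows "real_polynomial_function (\<lambda>z. L (pair_wedge z))"
proof -
  have L: "L w = (\<Sum>i\<in>UNIV. \<Sum>j\<in>UNIV. (mat_of_bivector w $ i $ j / 2) * L (axis i 1 \<and>\<^sub>b axis j 1))" for w
    by (subst bivector_expansion[of w]) (simp only: linear_sum[OF assms] linear_scale[OF assms] real_scaleR_def)
  show ?thesis
    by (subst L) (intro real_polynomial_function_sum finite_class.finite_UNIV
        real_polynomial_function.intros(2,4) polynomial_mat_of_pair_wedge)
qed

lemma polynomial_quadratic_pair_wedge:
  "real_polynomial_function (\<lambda>z. blinfun_apply R (pair_wedge z) \<bullet> pair_wedge z)"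
proof -
  have R: "R w \<bullet> w = (\<Sum>i\<in>UNIV. \<Sum>j\<in>UNIV. (mat_of_bivector w $ i $ j / 2)
      * (R w \<bullet> (axis i 1 \<and>\<^sub>b axis j 1)))" for w
    by (subst (2) bivector_expansion[of w]) (simp only: inner_sum_right inner_scaleR_right)
  have "linear (\<lambda>w. R w \<bullet> u)" for u
    by (intro bounded_linear.linear bounded_linear_compose[OF bounded_linear_inner_left]
        blinfun.bounded_linear_right)
  then have "real_polynomial_function (\<lambda>z. R (pair_wedge z) \<bullet> u)" for u
    by (rule polynomial_linear_pair_wedge)
  then show ?thesis
    by (subst R) (intro real_polynomial_function_sum finite_class.finite_UNIV
        real_polynomial_function.intros(4) polynomial_mat_of_pair_wedge)
qed

lemma polynomial_norm_pair_wedge: "real_polynomial_function (\<lambda>z. pair_wedge z \<bullet> pair_wedge z)"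
  using polynomial_quadratic_pair_wedge[of id_blinfun] by simp

lemma polynomial_curv_form: "real_polynomial_function (curv_form k R)"
  unfolding curv_form_def[abs_def]
  by (intro real_polynomial_function_diff real_polynomial_function.intros(2,4)
      polynomial_quadratic_pair_wedge polynomial_norm_pair_wedge)

lemma continuous_on_real_polynomial_function:
  "real_polynomial_function p \<Longrightarrow> continuous_on S p"
  by (simp add: continuous_on_polymonial_function real_polynomial_function_eq)

text \<open>Affine in the coordinates of the operator: the shape from which both kinds of matrix
  inequality are built.\<close>

lemma curv_form_sum:
  "curv_form k (\<Sum>i<N. x i *\<^sub>R v i) z
    = - k * (pair_wedge z \<bullet> pair_wedge z) + (\<Sum>i<N. x i * (v i (pair_wedge z) \<bullet> pair_wedge z))"
  by (simp add: curv_form_def blinfun.sum_left blinfun.scaleR_left inner_sum_left)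

lemma Sym2_b_R_sec_ge: "R \<in> R_sec_ge k \<Longrightarrow> R \<in> Sym2_b"
  by (simp add: R_sec_ge_def)

text \<open>The set of multiples \<open>(X, Y)\<close> of orthonormal pairs with \<open>\<bar>X\<bar>\<^sup>2 = \<bar>Y\<bar>\<^sup>2 = 1/2\<close>: on the unit
  sphere \<open>\<bar>X \<and> Y\<bar> \<le> 1/2\<close>, with equality precisely there.\<close>

definition stiefel :: "((real^'n) \<times> (real^'n::finite)) set"
  where "stiefel = {z. norm z = 1 \<and> pair_wedge z \<bullet> pair_wedge z - 1 / 4 = 0}"

lemma stiefel_Gr2: "z \<in> stiefel \<Longrightarrow> 2 *\<^sub>R pair_wedge z \<in> Gr2"
proof -
  assume "z \<in> stiefel"
  then have "norm (2 *\<^sub>R pair_wedge z) = 1"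
    by (simp add: stiefel_def norm_eq_1 del: norm_scaleR)
  moreover have "2 *\<^sub>R pair_wedge z = (2 *\<^sub>R fst z) \<and>\<^sub>b snd z"
    by (simp add: pair_wedge_def wedge_scaleR_left)
  ultimately show ?thesis unfolding Gr2_def by auto
qed

lemma Gr2_stiefel:
  assumes "\<sigma> \<in> Gr2"
  shows "\<exists>z\<in>stiefel. \<sigma> = 2 *\<^sub>R pair_wedge z"
proof -
  from assms obtain X Y where XY: "\<sigma> = X \<and>\<^sub>b Y" "norm \<sigma> = 1" unfolding Gr2_def by blast
  have "X \<noteq> 0"
  proof
    assume "X = 0"
    then have "\<sigma> = 0" using wedge_scaleR_left[of 0 X Y] XY(1) by simp
    then show False using XY(2) by simp
  qed
  \<comment> \<open>A Gram-Schmidt step; it does not change the wedge product with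
    \<open>X\<close>.\<close>
  define Y' where "Y' = Y + (- ((X \<bullet> Y) / (X \<bullet> X))) *\<^sub>R X"
  have orth: "X \<bullet> Y' = 0" using \<open>X \<noteq> 0\<close> by (simp add: Y'_def inner_diff_right)
  have "X \<and>\<^sub>b Y' = - (Y' \<and>\<^sub>b X)" by (rule wedge_swap)
  also have "Y' \<and>\<^sub>b X = Y \<and>\<^sub>b X"
    unfolding Y'_def wedge_add_left wedge_scaleR_left wedge_self by simp
  also have "- (Y \<and>\<^sub>b X) = X \<and>\<^sub>b Y" by (rule wedge_swap[symmetric])
  finally have "X \<and>\<^sub>b Y' = X \<and>\<^sub>b Y" .
  then have \<sigma>: "\<sigma> = X \<and>\<^sub>b Y'" using XY(1) by simp
  have "\<sigma> \<bullet> \<sigma> = 1" using XY(2) by (simp add: norm_eq_1)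
  then have one: "(X \<bullet> X) * (Y' \<bullet> Y') = 1"
    using orth by (simp add: \<sigma> inner_wedge inner_commute[of Y' X])
  \<comment> \<open>With this \<open>c\<close> the vector \<open>X / c\<close> has squared norm 1/2,
    and so has \<open>c Y' / 2\<close> because |X|^2 |Y'|^2 = 1.\<close>
  define c where "c = norm X * sqrt 2"
  have c: "c \<noteq> 0" "c\<^sup>2 = 2 * (X \<bullet> X)"
    using \<open>X \<noteq> 0\<close> by (simp_all add: c_def power_mult_distrib power2_norm_eq_inner)
  define z where "z = ((1 / c) *\<^sub>R X, (c / 2) *\<^sub>R Y')"
  have w: "pair_wedge z = (1 / 2) *\<^sub>R \<sigma>"
    using c(1) by (simp add: pair_wedge_def z_def \<sigma> wedge_scaleR_left wedge_scaleR_right)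
  have "z \<bullet> z = (X \<bullet> X) / c\<^sup>2 + c\<^sup>2 / 4 * (Y' \<bullet> Y')"
    by (simp add: z_def inner_Pair power2_eq_square field_simps)
  also have "\<dots> = 1"
    using \<open>X \<noteq> 0\<close> one by (simp add: c(2) mult.assoc)
  finally have "z \<in> stiefel"
    using \<open>\<sigma> \<bullet> \<sigma> = 1\<close> by (simp add: stiefel_def norm_eq_1 w)
  then show ?thesis using w by force
qed

lemma curv_form_stiefel:
  assumes "z \<in> stiefel"
  shows "curv_form k R z = (sec_curv R (2 *\<^sub>R pair_wedge z) - k) / 4"
  using assms by (simp add: curv_form_def sec_curv_def stiefel_def blinfun.scaleR_right field_simps)

lemma sec_curv_ge_iff_stiefel:
  "(\<forall>\<sigma>\<in>Gr2. sec_curv R \<sigma> \<ge> c) \<longleftrightarrow> (\<forall>z\<in>stiefel. curv_form k R z \<ge> (c - k) / 4)"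
proof
  assume "\<forall>\<sigma>\<in>Gr2. sec_curv R \<sigma> \<ge> c"
  then show "\<forall>z\<in>stiefel. curv_form k R z \<ge> (c - k) / 4"
    using stiefel_Gr2 by (fastforce simp: curv_form_stiefel)
next
  assume *: "\<forall>z\<in>stiefel. curv_form k R z \<ge> (c - k) / 4"
  show "\<forall>\<sigma>\<in>Gr2. sec_curv R \<sigma> \<ge> c"
  proof
    fix \<sigma> :: "'a bivector" assume "\<sigma> \<in> Gr2"
    then obtain z where z: "z \<in> stiefel" "\<sigma> = 2 *\<^sub>R pair_wedge z" using Gr2_stiefel by blast
    with * show "sec_curv R \<sigma> \<ge> c" by (force simp: curv_form_stiefel)
  qed
qed

lemma R_sec_ge_iff_stiefel:
  "R \<in> R_sec_ge k \<longleftrightarrow> R \<in> Sym2_b \<and> (\<forall>z\<in>stiefel. curv_form k R z \<ge> 0)"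
  unfolding R_sec_ge_def using sec_curv_ge_iff_stiefel[of k R k] by simp

text \<open>Off the degenerate pairs the form is |X \<and> Y|^2 (sec - k). Arbitrary pairs are
  needed because the outer sets integrate over the whole ball.\<close>

lemma curv_form_nonneg:
  assumes "R \<in> R_sec_ge k"
  shows "curv_form k R z \<ge> 0"
proof (cases "pair_wedge z = 0")
  case True
  then show ?thesis by (simp add: curv_form_def blinfun.zero_right)
next
  case False
  define w where "w = pair_wedge z"
  have "(1 / norm w) *\<^sub>R w = ((1 / norm w) *\<^sub>R fst z) \<and>\<^sub>b snd z"
    by (simp add: w_def pair_wedge_def wedge_scaleR_left)
  moreover have "norm ((1 / norm w) *\<^sub>R w) = 1" using False by (simp add: w_def)
  ultimately have "(1 / norm w) *\<^sub>R w \<in> Gr2" unfolding Gr2_def by auto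
  then have "k \<le> sec_curv R ((1 / norm w) *\<^sub>R w)"
    using assms by (simp add: R_sec_ge_def)
  also have "\<dots> = (R w \<bullet> w) / (w \<bullet> w)"
    by (simp add: sec_curv_def blinfun.scaleR_right flip: power2_norm_eq_inner)
      (simp add: power2_eq_square)
  finally show ?thesis
    using False by (simp add: curv_form_def w_def field_simps)
qed

section \<open>The orthogonal group action\<close>

lemma matrix_inner_transpose:
  fixes g :: "real^'n^'n"
  shows "(g *v X) \<bullet> Z = X \<bullet> (transpose g *v Z)"
  by (metis dot_lmul_matrix inner_commute transpose_matrix_vector)

text \<open>Reduces identities for \<open>wedge2\<close> to decomposable bivectors, where
  \<open>wedge2_wedge\<close> and \<open>inner_wedge\<close> compute both sides.\<close>

lemma bivector_linear_eqI:
  fixes f h :: "'n::finite bivector \<Rightarrow> 'b::real_vector"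
  assumes "linear f" "linear h" "\<And>X Y. f (X \<and>\<^sub>b Y) = h (X \<and>\<^sub>b Y)"
  shows "f w = h w"
  by (rule linear_eq_on_span[OF assms(1,2), of "range (\<lambda>(X, Y). X \<and>\<^sub>b Y)"])
    (use assms(3) span_wedge in auto)

lemma wedge2_adjoint: "wedge2 g v \<bullet> w = v \<bullet> wedge2 (transpose g) w"
proof -
  have lin: "linear (\<lambda>v. wedge2 h v \<bullet> w)" "linear (\<lambda>v. w \<bullet> wedge2 h v)" "linear (\<lambda>v. v \<bullet> w)" "linear (\<lambda>v. w \<bullet> v)"
    for h :: "real^'n^'n" and w :: "'n bivector"
    using linear_wedge2[of h]
    by (auto intro!: linearI simp: linear_add linear_scale inner_add_left inner_add_right)
  have *: "wedge2 g (X \<and>\<^sub>b Y) \<bullet> w = (X \<and>\<^sub>b Y) \<bullet> wedge2 (transpose g) w" for X Y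
    by (rule bivector_linear_eqI[OF lin(4)[of "wedge2 g (X \<and>\<^sub>b Y)"] lin(2)[of "X \<and>\<^sub>b Y" "transpose g"]])
      (simp only: wedge2_wedge inner_wedge matrix_inner_transpose)
  show ?thesis
    by (rule bivector_linear_eqI[OF lin(1)[of g w] lin(3)[of "wedge2 (transpose g) w"]]) (rule *)
qed

lemma wedge2_inverse:
  fixes g :: "real^'n^'n"
  assumes "orthogonal_matrix g"
  shows "wedge2 g (wedge2 (transpose g) w) = w" "wedge2 (transpose g) (wedge2 g w) = w"
proof -
  have g: "g *v (transpose g *v X) = X" "transpose g *v (g *v X) = X" for X
    using assms by (simp_all only: matrix_vector_mul_assoc orthogonal_matrix_def matrix_vector_mul_lid)
  have lin: "linear (\<lambda>w. wedge2 h (wedge2 h' w))" "linear (\<lambda>w :: 'n bivector. w)" for h h' :: "real^'n^'n"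
    using linear_compose[OF linear_wedge2[of h'] linear_wedge2[of h]] by (simp_all add: o_def linear_id[unfolded id_def])
  show "wedge2 g (wedge2 (transpose g) w) = w" "wedge2 (transpose g) (wedge2 g w) = w"
    by (rule bivector_linear_eqI[OF lin]; simp only: wedge2_wedge g)+
qed

lemma orth_act_apply:
  assumes "orthogonal_matrix g"
  shows "orth_act g R w = wedge2 g (R (wedge2 (transpose g) w))"
  by (simp add: blinfun_apply_orth_act[OF assms] inv_wedge2[OF assms])

lemma orth_act_inverse:
  assumes "orthogonal_matrix g"
  shows "orth_act g (orth_act (transpose g) R) = R"
proof (rule blinfun_eqI)
  fix w
  have "orthogonal_matrix (transpose g)" using assms by (simp add: orthogonal_matrix_def)
  then show "orth_act g (orth_act (transpose g) R) w = R w"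
    using assms by (simp add: orth_act_apply wedge2_inverse)
qed

text \<open>The reverse inclusion is the hypothesis for the inverse element
  \<open>transpose g\<close>.\<close>

lemma O_invariantI:
  assumes "\<And>g R. orthogonal_matrix g \<Longrightarrow> R \<in> S \<Longrightarrow> orth_act g R \<in> S"
  shows "O_invariant S"
  unfolding O_invariant_def
proof (intro allI impI equalityI subsetI)
  fix g :: "real^'a^'a" and R assume g: "orthogonal_matrix g" and "R \<in> S"
  have "orthogonal_matrix (transpose g)" using g by (simp add: orthogonal_matrix_def)
  then have "orth_act (transpose g) R \<in> S" using \<open>R \<in> S\<close> by (rule assms)
  then show "R \<in> orth_act g ` S" using orth_act_inverse[OF g, of R] by (metis imageI)
qed (use assms in auto)

lemma orth_act_inner:
  assumes "orthogonal_matrix g"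
  shows "orth_act g R v \<bullet> w = R (wedge2 (transpose g) v) \<bullet> wedge2 (transpose g) w"
  by (simp add: orth_act_apply[OF assms] wedge2_adjoint)

lemma orth_act_Sym2_b:
  assumes g: "orthogonal_matrix g" and R: "R \<in> Sym2_b"
  shows "orth_act g R \<in> Sym2_b"
proof -
  have "orth_act g R v \<bullet> w = v \<bullet> orth_act g R w" for v w
    using R orth_act_inner[OF g, of R v w] orth_act_inner[OF g, of R w v]
    by (simp add: Sym2_b_def Sym2_def inner_commute)
  moreover have "orth_act g R (X \<and>\<^sub>b Y) \<bullet> (Z \<and>\<^sub>b W) + orth_act g R (Y \<and>\<^sub>b Z) \<bullet> (X \<and>\<^sub>b W)
      + orth_act g R (Z \<and>\<^sub>b X) \<bullet> (Y \<and>\<^sub>b W) = 0" for X Y Z W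
    unfolding orth_act_inner[OF g] wedge2_wedge using R unfolding Sym2_b_def by blast
  ultimately show ?thesis unfolding Sym2_b_def Sym2_def by blast
qed

definition pair_act :: "real^'n^'n \<Rightarrow> (real^'n) \<times> (real^'n) \<Rightarrow> (real^'n) \<times> (real^'n)"
  where "pair_act g z = (g *v fst z, g *v snd z)"

lemma pair_wedge_pair_act: "pair_wedge (pair_act g z) = wedge2 g (pair_wedge z)"
  by (simp add: pair_wedge_def pair_act_def wedge2_wedge)

lemma linear_pair_act: "linear (pair_act g)"
  by (rule linearI) (simp_all add: pair_act_def matrix_vector_right_distrib matrix_vector_mult_scaleR)

lemma pair_act_inverse:
  assumes "orthogonal_matrix g"
  shows "pair_act g (pair_act (transpose g) z) = z"
  using assms by (simp only: pair_act_def fst_conv snd_conv matrix_vector_mul_assoc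
      orthogonal_matrix_def matrix_vector_mul_lid prod.collapse)

lemma orthogonal_pair_act:
  assumes "orthogonal_matrix g"
  shows "orthogonal_transformation (pair_act g)"
proof -
  have "(g *v X) \<bullet> (g *v Y) = X \<bullet> Y" for X Y
    using assms by (simp only: matrix_inner_transpose matrix_vector_mul_assoc
        orthogonal_matrix_def matrix_vector_mul_lid)
  then show ?thesis
    unfolding orthogonal_transformation_def by (simp add: linear_pair_act pair_act_def inner_prod_def)
qed

text \<open>Transfers the action from operators to pairs; both invariance proofs rest on it.\<close>

lemma curv_form_orth_act:
  assumes "orthogonal_matrix g"
  shows "curv_form k (orth_act g R) z = curv_form k R (pair_act (transpose g) z)"
proof -
  have "wedge2 (transpose g) w \<bullet> wedge2 (transpose g) w = w \<bullet> w" for w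
    using wedge2_adjoint[of "transpose g" w "wedge2 (transpose g) w"]
    by (simp add: wedge2_inverse[OF assms])
  then show ?thesis
    by (simp add: curv_form_def pair_wedge_pair_act orth_act_inner[OF assms])
qed

lemma pair_act_stiefel:
  assumes "orthogonal_matrix g" "z \<in> stiefel"
  shows "pair_act g z \<in> stiefel"
proof -
  have "wedge2 g w \<bullet> wedge2 g w = w \<bullet> w" for w
    by (simp add: wedge2_adjoint wedge2_inverse[OF assms(1)])
  then show ?thesis
    using assms(2) orthogonal_transformation_norm[OF orthogonal_pair_act[OF assms(1)]]
    by (simp add: stiefel_def pair_wedge_pair_act)
qed

section \<open>The space of algebraic curvature operators\<close>

lemma subspace_Sym2_b: "subspace Sym2_b"
proof (rule subspaceI)
  show "0 \<in> Sym2_b" by (simp add: Sym2_b_def Sym2_def)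
  fix R S :: "'a bivector_endo" assume RS: "R \<in> Sym2_b" "S \<in> Sym2_b"
  show "R + S \<in> Sym2_b"
    unfolding Sym2_b_def Sym2_def
  proof (safe, goal_cases)
    case (1 v w)
    then show ?case using RS by (simp add: Sym2_b_def Sym2_def blinfun.add_left inner_add_left inner_add_right)
  next
    case (2 X Y Z W)
    have "R (X \<and>\<^sub>b Y) \<bullet> (Z \<and>\<^sub>b W) + R (Y \<and>\<^sub>b Z) \<bullet> (X \<and>\<^sub>b W) + R (Z \<and>\<^sub>b X) \<bullet> (Y \<and>\<^sub>b W) = 0"
      "S (X \<and>\<^sub>b Y) \<bullet> (Z \<and>\<^sub>b W) + S (Y \<and>\<^sub>b Z) \<bullet> (X \<and>\<^sub>b W) + S (Z \<and>\<^sub>b X) \<bullet> (Y \<and>\<^sub>b W) = 0"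
      using RS unfolding Sym2_b_def by blast+
    then show ?case by (simp add: blinfun.add_left inner_add_left)
  qed
next
  fix c and R :: "'a bivector_endo" assume R: "R \<in> Sym2_b"
  show "c *\<^sub>R R \<in> Sym2_b"
    unfolding Sym2_b_def Sym2_def
  proof (safe, goal_cases)
    case (1 v w)
    then show ?case using R by (simp add: Sym2_b_def Sym2_def blinfun.scaleR_left)
  next
    case (2 X Y Z W)
    have "R (X \<and>\<^sub>b Y) \<bullet> (Z \<and>\<^sub>b W) + R (Y \<and>\<^sub>b Z) \<bullet> (X \<and>\<^sub>b W) + R (Z \<and>\<^sub>b X) \<bullet> (Y \<and>\<^sub>b W) = 0"
      using R unfolding Sym2_b_def by blast
    then show ?case by (simp add: blinfun.scaleR_left flip: distrib_left)
  qed
qed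

text \<open>The identity has constant sectional curvature 1 and is the direction in which operators
  are perturbed to make the form positive.\<close>

lemma id_Sym2_b: "id_blinfun \<in> Sym2_b"
  unfolding Sym2_b_def Sym2_def by (simp add: inner_wedge inner_commute algebra_simps)

text \<open>An operator is determined by the matrices of its values on the bivectors
  \<open>?e i j\<close>, which embeds the space linearly into a Euclidean space.\<close>

lemma independent_bivector_endo_finite:
  fixes B :: "'n::finite bivector_endo set"
  assumes "independent B"
  shows "finite B"
proof -
  let ?e = "\<lambda>i j. axis i 1 \<and>\<^sub>b axis j 1 :: 'n bivector"
  define f :: "'n bivector_endo \<Rightarrow> real^'n^'n^'n^'n"
    where "f R = (\<chi> i j. mat_of_bivector (R (?e i j)))" for R
  have lin: "linear f"
    by (rule linearI) (simp_all add: f_def vec_eq_iff blinfun.add_left blinfun.scaleR_left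
        mat_of_bivector_add mat_of_bivector_scaleR)
  have "inj f"
  proof (rule injI)
    fix R S assume "f R = f S"
    then have e: "R (?e i j) = S (?e i j)" for i j
      by (simp add: f_def vec_eq_iff flip: mat_of_bivector_inject)
    show "R = S"
    proof (rule blinfun_eqI)
      fix w
      show "R w = S w"
        by (subst (1 2) bivector_expansion[of w])
          (simp only: blinfun.sum_right blinfun.scaleR_right e)
    qed
  qed
  note inj = inj_on_subset[OF this subset_UNIV]
  have "independent (f ` B)"
    by (rule linear_independent_injective_image[OF lin assms inj])
  then have "finite (f ` B)" by (rule independent_imp_finite)
  then show ?thesis using inj by (rule finite_imageD)
qed

lemma Sym2_b_coordinates:
  obtains N v where "coord_iso N (\<lambda>x. \<Sum>i<N. x i *\<^sub>R v i) (Sym2_b :: 'n::finite bivector_endo set)"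
  using coord_iso_subspace[OF subspace_Sym2_b independent_bivector_endo_finite] by blast

lemma closed_R_sec_ge: "closed (R_sec_ge k)"
proof -
  have cont: "continuous_on UNIV (\<lambda>R :: 'a bivector_endo. R v \<bullet> w)" for v w
    by (intro continuous_intros)
  have "R_sec_ge k = (\<Inter>v. \<Inter>w. {R :: 'a bivector_endo. R v \<bullet> w = R w \<bullet> v})
      \<inter> (\<Inter>X. \<Inter>Y. \<Inter>Z. \<Inter>W. {R :: 'a bivector_endo. R (X \<and>\<^sub>b Y) \<bullet> (Z \<and>\<^sub>b W) + R (Y \<and>\<^sub>b Z) \<bullet> (X \<and>\<^sub>b W) + R (Z \<and>\<^sub>b X) \<bullet> (Y \<and>\<^sub>b W) = 0})
      \<inter> (\<Inter>\<sigma>\<in>Gr2. {R :: 'a bivector_endo. k \<le> R \<sigma> \<bullet> \<sigma>})"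
    unfolding R_sec_ge_def Sym2_b_def Sym2_def sec_curv_def by (auto simp: inner_commute)
  also have "closed \<dots>"
    by (intro closed_Int closed_INT ballI closed_Collect_eq closed_Collect_le cont continuous_on_add continuous_on_const)
  finally show ?thesis .
qed

section \<open>The inner approximations\<close>

definition inner_approx :: "real \<Rightarrow> nat \<Rightarrow> ('n::finite) bivector_endo set"
  where "inner_approx k m = {R \<in> Sym2_b. sos_degree stiefel m (curv_form k R)}"

lemma spectrahedral_shadow_inner_approx: "spectrahedral_shadow_in Sym2_b (inner_approx k m)"
proof -
  obtain N v where \<phi>: "coord_iso N (\<lambda>x. \<Sum>i<N. x i *\<^sub>R v i) (Sym2_b :: 'a bivector_endo set)"
    by (rule Sym2_b_coordinates)
  let ?\<phi> = "\<lambda>x. \<Sum>i<N. x i *\<^sub>R v i"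
  have "curv_form k (?\<phi> x) = (\<lambda>z. - k * (pair_wedge z \<bullet> pair_wedge z)
      + (\<Sum>i<N. x i * (v i (pair_wedge z) \<bullet> pair_wedge z)))" for x
    by (rule ext) (rule curv_form_sum)
  then have "spectrahedral_shadow N {x \<in> rspace N. sos_degree stiefel m (curv_form k (?\<phi> x))}"
    unfolding sos_degree_def by (simp only: spectrahedral_shadow_gram_rep)
  moreover have "inner_approx k m = ?\<phi> ` {x \<in> rspace N. sos_degree stiefel m (curv_form k (?\<phi> x))}"
    unfolding inner_approx_def by (rule coord_iso_image_Collect[OF \<phi>, symmetric])
  ultimately show ?thesis
    unfolding spectrahedral_shadow_in_def using \<phi> by blast
qed

lemma O_invariant_inner_approx: "O_invariant (inner_approx k m)"
proof (rule O_invariantI)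
  fix g :: "real^'a^'a" and R :: "'a bivector_endo"
  assume g: "orthogonal_matrix g" and R: "R \<in> inner_approx k m"
  have g': "orthogonal_matrix (transpose g)" using g by (simp add: orthogonal_matrix_def)
  have "sos_degree stiefel m (curv_form k R)" using R by (simp add: inner_approx_def)
  then have "sos_degree stiefel m (\<lambda>z. curv_form k R (pair_act (transpose g) z))"
    by (rule sos_degree_compose[where h = "pair_act (transpose g)"])
      (use pair_act_stiefel[OF g'] fspan_monomials_linear[OF linear_pair_act] in simp_all)
  then have "sos_degree stiefel m (curv_form k (orth_act g R))"
    by (simp add: curv_form_orth_act[OF g, abs_def])
  then show "orth_act g R \<in> inner_approx k m"
    using R orth_act_Sym2_b[OF g] by (simp add: inner_approx_def)
qed

lemma inner_approx_subset: "inner_approx k m \<subseteq> R_sec_ge k"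
proof
  fix R :: "'a bivector_endo" assume R: "R \<in> inner_approx k m"
  have "curv_form k R z \<ge> 0" if "z \<in> stiefel" for z
    using R that unfolding inner_approx_def sos_degree_def by (intro gram_rep_nonneg) auto
  then show "R \<in> R_sec_ge k" using R by (simp add: R_sec_ge_iff_stiefel inner_approx_def)
qed

lemma inner_approx_mono: "m \<le> n \<Longrightarrow> inner_approx k m \<subseteq> inner_approx k n"
  unfolding inner_approx_def by (intro Collect_mono impI) (auto elim: sos_degree_mono)

lemma strictly_positive_in_inner_approx:
  fixes R :: "'n::finite bivector_endo"
  assumes "R \<in> Sym2_b" "\<And>z. z \<in> stiefel \<Longrightarrow> curv_form k R z > 0"
  shows "\<exists>m. R \<in> inner_approx k m"
proof -
  have "real_polynomial_function (\<lambda>z :: (real^'n) \<times> (real^'n). pair_wedge z \<bullet> pair_wedge z - 1 / 4)"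
    by (intro real_polynomial_function_diff polynomial_norm_pair_wedge real_polynomial_function.intros(2))
  then have "sos_on stiefel (curv_form k R)"
    unfolding stiefel_def
    by (rule positive_polynomial_sos_on[OF polynomial_curv_form]) (simp add: assms(2) stiefel_def)
  then obtain m where "sos_degree stiefel m (curv_form k R)" using sos_on_sos_degree by blast
  then show ?thesis using assms(1) by (intro exI[of _ m]) (simp add: inner_approx_def)
qed

lemma closure_inner_approx:
  "closure (\<Union>m. inner_approx k m) = (R_sec_ge k :: 'n::finite bivector_endo set)"
proof
  show "closure (\<Union>m. inner_approx k m) \<subseteq> (R_sec_ge k :: 'n bivector_endo set)"
    by (intro closure_minimal closed_R_sec_ge UN_least inner_approx_subset)
  show "(R_sec_ge k :: 'n bivector_endo set) \<subseteq> closure (\<Union>m. inner_approx k m)"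
  proof
    fix R :: "'n bivector_endo" assume R: "R \<in> R_sec_ge k"
    \<comment> \<open>On \<open>stiefel\<close> this perturbation adds
      \<open>1 / (4 * Suc n)\<close> to the form.\<close>
    define S where "S n = R + (1 / Suc n) *\<^sub>R id_blinfun" for n :: nat
    have "S n \<in> (\<Union>m. inner_approx k m)" for n
    proof -
      have "curv_form k (S n) z = curv_form k R z + 1 / Suc n * (1 / 4)" if "z \<in> stiefel" for z
      proof -
        have "pair_wedge z \<bullet> pair_wedge z = 1 / 4" using that by (simp add: stiefel_def)
        moreover have "curv_form k (S n) z
            = curv_form k R z + 1 / Suc n * (pair_wedge z \<bullet> pair_wedge z)"
          by (simp add: S_def curv_form_def blinfun.add_left blinfun.scaleR_left inner_add_left)
        ultimately show ?thesis by (simp only:)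
      qed
      moreover have "curv_form k R z \<ge> 0" for z using curv_form_nonneg[OF R] .
      ultimately have "curv_form k (S n) z > 0" if "z \<in> stiefel" for z
        using that by (simp add: add_nonneg_pos)
      moreover have "S n \<in> Sym2_b"
        unfolding S_def using Sym2_b_R_sec_ge[OF R]
        by (intro subspace_add subspace_scale subspace_Sym2_b id_Sym2_b)
      ultimately show ?thesis using strictly_positive_in_inner_approx by blast
    qed
    moreover have "S \<longlonglongrightarrow> R"
    proof -
      have "(\<lambda>n. R + (1 / real (Suc n)) *\<^sub>R id_blinfun) \<longlonglongrightarrow> R + 0 *\<^sub>R id_blinfun"
        by (intro tendsto_intros LIMSEQ_Suc[OF lim_1_over_n])
      then show ?thesis by (simp add: S_def[abs_def])
    qed
    ultimately show "R \<in> closure (\<Union>m. inner_approx k m)"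
      unfolding closure_sequential by blast
  qed
qed

section \<open>The outer approximations\<close>

definition outer_approx :: "real \<Rightarrow> nat \<Rightarrow> ('n::finite) bivector_endo set"
  where "outer_approx k m = {R \<in> Sym2_b. \<forall>p. fspan (monomials m) p \<longrightarrow>
    ball_integral (\<lambda>z. curv_form k R z * (p z)\<^sup>2) \<ge> 0}"

lemma polynomial_monomials:
  fixes q :: "'v::euclidean_space \<Rightarrow> real"
  shows "q \<in> monomials m \<Longrightarrow> real_polynomial_function q"
proof (induction m arbitrary: q)
  case 0
  then show ?case by (simp add: real_polynomial_function.intros(2))
next
  case (Suc m)
  have "real_polynomial_function (\<lambda>x. (x \<bullet> e) * q' x)" if "q' \<in> monomials m"
    for e :: 'v and q' :: "'v \<Rightarrow> real"
    by (intro real_polynomial_function.intros(4) Suc.IH[OF that])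
      (intro real_polynomial_function.intros(1) bounded_linear_inner_left)
  then show ?case using Suc by auto
qed

lemma polynomial_fspan:
  assumes "fspan Q p" "\<And>q. q \<in> Q \<Longrightarrow> real_polynomial_function q"
  shows "real_polynomial_function p"
  using assms(1)
proof (induction rule: fspan.induct)
  case (step q F c)
  then show ?case
    using assms(2)[OF step.hyps(1)] by (intro real_polynomial_function.intros(2-4))
qed (rule real_polynomial_function.intros(2))

text \<open>The integrals of \<open>F * b a * b c\<close> are the entries of a localizing moment
  matrix; testing against all squares amounts to its positive semidefiniteness.\<close>

lemma ball_integral_square_form:
  assumes "continuous_on UNIV F" "\<And>a. a < r \<Longrightarrow> continuous_on UNIV (b a)"
  shows "ball_integral (\<lambda>z. F z * (\<Sum>a<r. v a * b a z)\<^sup>2)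
    = (\<Sum>a<r. \<Sum>c<r. v a * ball_integral (\<lambda>z. F z * (b a z * b c z)) * v c)"
proof -
  have "F z * (\<Sum>a<r. v a * b a z)\<^sup>2 = (\<Sum>a<r. \<Sum>c<r. (v a * v c) * (F z * (b a z * b c z)))" for z
  proof -
    have "(\<Sum>a<r. v a * b a z)\<^sup>2 = (\<Sum>a<r. \<Sum>c<r. (v a * b a z) * (v c * b c z))"
      by (simp only: power2_eq_square sum_product)
    then show ?thesis by (simp add: sum_distrib_left mult_ac)
  qed
  then have "ball_integral (\<lambda>z. F z * (\<Sum>a<r. v a * b a z)\<^sup>2)
      = ball_integral (\<lambda>z. \<Sum>a<r. \<Sum>c<r. (v a * v c) * (F z * (b a z * b c z)))" by simp
  also have "\<dots> = (\<Sum>a<r. ball_integral (\<lambda>z. \<Sum>c<r. (v a * v c) * (F z * (b a z * b c z))))"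
    by (intro ball_integral_sum continuous_intros assms) auto
  also have "\<dots> = (\<Sum>a<r. \<Sum>c<r. ball_integral (\<lambda>z. (v a * v c) * (F z * (b a z * b c z))))"
    by (intro sum.cong refl ball_integral_sum continuous_intros assms) auto
  also have "\<dots> = (\<Sum>a<r. \<Sum>c<r. v a * ball_integral (\<lambda>z. F z * (b a z * b c z)) * v c)"
    by (intro sum.cong refl) (simp add: ball_integral_cmult)
  finally show ?thesis .
qed

lemma spectrahedron_outer_approx: "spectrahedron_in Sym2_b (outer_approx k m)"
proof -
  obtain N v where \<phi>: "coord_iso N (\<lambda>x. \<Sum>i<N. x i *\<^sub>R v i) (Sym2_b :: 'a bivector_endo set)"
    by (rule Sym2_b_coordinates)
  let ?\<phi> = "\<lambda>x. \<Sum>i<N. x i *\<^sub>R v i" and ?w = "pair_wedge :: _ \<Rightarrow> 'a bivector"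
  define l :: "((real^'a) \<times> (real^'a) \<Rightarrow> real) list" where "l = monomial_list m"
  define r where "r = length l"
  define b where "b a = l ! a" for a
  have b: "b ` {..<r} = monomials m"
    unfolding b_def[abs_def] r_def l_def by (rule nth_image_monomial_list)
  have cont_b: "continuous_on UNIV (b a)" if "a < r" for a
  proof -
    have "b a \<in> monomials m" unfolding b[symmetric] using that by simp
    then show ?thesis by (intro continuous_on_real_polynomial_function polynomial_monomials)
  qed
  have cont_w: "continuous_on UNIV (\<lambda>z. ?w z \<bullet> ?w z)" "continuous_on UNIV (\<lambda>z. v i (?w z) \<bullet> ?w z)" for i
    by (intro continuous_on_real_polynomial_function polynomial_norm_pair_wedge
        polynomial_quadratic_pair_wedge)+
  \<comment> \<open>The moment matrix of the curvature form, split as in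
    \<open>curv_form_sum\<close> into its constant part \<open>A\<close> and the coefficients
    \<open>B i\<close> of the coordinates.\<close>
  define A where "A a c = ball_integral (\<lambda>z. - k * (?w z \<bullet> ?w z) * (b a z * b c z))" for a c
  define B where "B i a c = ball_integral (\<lambda>z. (v i (?w z) \<bullet> ?w z) * (b a z * b c z))" for i a c
  have M: "A a c + (\<Sum>i<N. x i * B i a c) = ball_integral (\<lambda>z. curv_form k (?\<phi> x) z * (b a z * b c z))"
    if "a < r" "c < r" for a c x
  proof -
    have "ball_integral (\<lambda>z. curv_form k (?\<phi> x) z * (b a z * b c z))
        = ball_integral (\<lambda>z. - k * (?w z \<bullet> ?w z) * (b a z * b c z)
          + (\<Sum>i<N. x i * ((v i (?w z) \<bullet> ?w z) * (b a z * b c z))))"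
      by (simp only: curv_form_sum distrib_right sum_distrib_right mult.assoc)
    also have "\<dots> = A a c + ball_integral (\<lambda>z. \<Sum>i<N. x i * ((v i (?w z) \<bullet> ?w z) * (b a z * b c z)))"
      unfolding A_def using that by (intro ball_integral_add continuous_intros cont_w cont_b)
    also have "\<dots> = A a c + (\<Sum>i<N. ball_integral (\<lambda>z. x i * ((v i (?w z) \<bullet> ?w z) * (b a z * b c z))))"
      using that by (subst ball_integral_sum) (auto intro!: continuous_intros cont_w cont_b)
    finally show ?thesis by (simp add: ball_integral_cmult B_def)
  qed
  have AB_sym: "A a c = A c a" "B i a c = B i c a" for i a c
    unfolding A_def B_def mult.commute[of "b a _"] by (rule refl)+
  have "sym_mat r A" "sym_mat r (B i)" for i
    unfolding sym_mat_def using AB_sym by blast+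
  moreover have "psd_mat r (\<lambda>a c. A a c + (\<Sum>i<N. x i * B i a c)) \<longleftrightarrow>
      (\<forall>p. fspan (monomials m) p \<longrightarrow> ball_integral (\<lambda>z. curv_form k (?\<phi> x) z * (p z)\<^sup>2) \<ge> 0)" for x
  proof -
    have "sym_mat r (\<lambda>a c. A a c + (\<Sum>i<N. x i * B i a c))"
      unfolding sym_mat_def using AB_sym by simp
    moreover have "(\<Sum>a<r. \<Sum>c<r. u a * (A a c + (\<Sum>i<N. x i * B i a c)) * u c)
        = ball_integral (\<lambda>z. curv_form k (?\<phi> x) z * (\<Sum>a<r. u a * b a z)\<^sup>2)" for u
    proof -
      have "ball_integral (\<lambda>z. curv_form k (?\<phi> x) z * (\<Sum>a<r. u a * b a z)\<^sup>2)
          = (\<Sum>a<r. \<Sum>c<r. u a * ball_integral (\<lambda>z. curv_form k (?\<phi> x) z * (b a z * b c z)) * u c)"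
        by (intro ball_integral_square_form continuous_on_real_polynomial_function[OF polynomial_curv_form]
            cont_b)
      also have "\<dots> = (\<Sum>a<r. \<Sum>c<r. u a * (A a c + (\<Sum>i<N. x i * B i a c)) * u c)"
        by (intro sum.cong refl) (simp add: M)
      finally show ?thesis by simp
    qed
    ultimately have "psd_mat r (\<lambda>a c. A a c + (\<Sum>i<N. x i * B i a c)) \<longleftrightarrow>
        (\<forall>u. ball_integral (\<lambda>z. curv_form k (?\<phi> x) z * (\<Sum>a<r. u a * b a z)\<^sup>2) \<ge> 0)"
      by (simp add: psd_mat_def)
    also have "\<dots> \<longleftrightarrow> (\<forall>p. fspan (monomials m) p \<longrightarrow> ball_integral (\<lambda>z. curv_form k (?\<phi> x) z * (p z)\<^sup>2) \<ge> 0)"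
    proof safe
      fix p :: "(real^'a) \<times> (real^'a) \<Rightarrow> real"
      assume *: "\<forall>u. ball_integral (\<lambda>z. curv_form k (?\<phi> x) z * (\<Sum>a<r. u a * b a z)\<^sup>2) \<ge> 0"
        and p: "fspan (monomials m) p"
      obtain u where "\<And>z. p z = (\<Sum>a<r. u a * b a z)"
        using fspan_coeffs[of b r p] p b by auto
      then show "ball_integral (\<lambda>z. curv_form k (?\<phi> x) z * (p z)\<^sup>2) \<ge> 0" using * by simp
    next
      fix u assume *: "\<forall>p. fspan (monomials m) p \<longrightarrow> ball_integral (\<lambda>z. curv_form k (?\<phi> x) z * (p z)\<^sup>2) \<ge> 0"
      have "fspan (monomials m) (\<lambda>z. \<Sum>a<r. u a * b a z)"
        using b by (intro fspan_sum fspan_scale fspan_base) auto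
      then show "ball_integral (\<lambda>z. curv_form k (?\<phi> x) z * (\<Sum>a<r. u a * b a z)\<^sup>2) \<ge> 0" using * by blast
    qed
    finally show ?thesis .
  qed
  ultimately have "spectrahedron N {x \<in> rspace N. \<forall>p. fspan (monomials m) p \<longrightarrow>
      ball_integral (\<lambda>z. curv_form k (?\<phi> x) z * (p z)\<^sup>2) \<ge> 0}"
    unfolding spectrahedron_def by (intro exI[of _ r] exI[of _ A] exI[of _ B]) simp
  moreover have "outer_approx k m = ?\<phi> ` {x \<in> rspace N. \<forall>p. fspan (monomials m) p \<longrightarrow>
      ball_integral (\<lambda>z. curv_form k (?\<phi> x) z * (p z)\<^sup>2) \<ge> 0}"
    unfolding outer_approx_def
    by (rule coord_iso_image_Collect[OF \<phi>, symmetric, where P = "\<lambda>R. \<forall>p. fspan (monomials m) p \<longrightarrow>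
      ball_integral (\<lambda>z. curv_form k R z * (p z)\<^sup>2) \<ge> 0"])
  ultimately show ?thesis
    unfolding spectrahedron_in_def using \<phi> by blast
qed

text \<open>Changing variables by the isometry \<open>pair_act g\<close>, testing the transformed
  operator against \<open>p\<close> becomes testing \<open>R\<close> against \<open>p\<close>
  composed with \<open>pair_act g\<close>, of the same degree.\<close>

lemma O_invariant_outer_approx: "O_invariant (outer_approx k m)"
proof (rule O_invariantI)
  fix g :: "real^'a^'a" and R :: "'a bivector_endo"
  assume g: "orthogonal_matrix g" and R: "R \<in> outer_approx k m"
  have g': "orthogonal_matrix (transpose g)" using g by (simp add: orthogonal_matrix_def)
  have "ball_integral (\<lambda>z. curv_form k (orth_act g R) z * (p z)\<^sup>2) \<ge> 0"
    if p: "fspan (monomials m) p" for p :: "(real^'a) \<times> (real^'a) \<Rightarrow> real"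
  proof -
    let ?F = "\<lambda>z. curv_form k R z * (p (pair_act g z))\<^sup>2"
    have p': "fspan (monomials m) (\<lambda>z. p (pair_act g z))"
      by (rule fspan_compose[OF p]) (rule fspan_monomials_linear[OF linear_pair_act])
    have "continuous_on UNIV ?F"
      by (intro continuous_intros continuous_on_real_polynomial_function polynomial_curv_form
          polynomial_fspan[OF p' polynomial_monomials])
    then have "ball_integral (\<lambda>z. ?F (pair_act (transpose g) z)) = ball_integral ?F"
      by (rule ball_integral_orthogonal[OF orthogonal_pair_act[OF g']])
    then show ?thesis
      using R p' by (simp add: curv_form_orth_act[OF g] pair_act_inverse[OF g] outer_approx_def)
  qed
  then show "orth_act g R \<in> outer_approx k m"
    using R orth_act_Sym2_b[OF g] by (simp add: outer_approx_def)
qed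

lemma R_sec_ge_subset_outer_approx: "R_sec_ge k \<subseteq> outer_approx k m"
proof
  fix R :: "'a bivector_endo" assume R: "R \<in> R_sec_ge k"
  have "ball_integral (\<lambda>z. curv_form k R z * (p z)\<^sup>2) \<ge> 0" for p
    by (intro ball_integral_nonneg mult_nonneg_nonneg curv_form_nonneg[OF R]) simp
  then show "R \<in> outer_approx k m"
    using Sym2_b_R_sec_ge[OF R] by (simp add: outer_approx_def)
qed

lemma outer_approx_antimono:
  assumes "m \<le> n"
  shows "outer_approx k n \<subseteq> outer_approx k m"
  unfolding outer_approx_def
proof (intro Collect_mono impI conjI allI)
  fix R :: "'a bivector_endo" and p :: "(real^'a) \<times> (real^'a) \<Rightarrow> real"
  assume *: "R \<in> Sym2_b \<and> (\<forall>p. fspan (monomials n) p \<longrightarrow> ball_integral (\<lambda>z. curv_form k R z * (p z)\<^sup>2) \<ge> 0)"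
  then show "R \<in> Sym2_b" ..
  assume "fspan (monomials m) p"
  then have "fspan (monomials n) p" by (rule fspan_mono) (rule monomials_mono[OF assms])
  with * show "ball_integral (\<lambda>z. curv_form k R z * (p z)\<^sup>2) \<ge> 0" by blast
qed

lemma Inter_outer_approx:
  "(\<Inter>m. outer_approx k m) = (R_sec_ge k :: 'n::finite bivector_endo set)"
proof
  show "(R_sec_ge k :: 'n bivector_endo set) \<subseteq> (\<Inter>m. outer_approx k m)"
    by (rule INT_greatest) (rule R_sec_ge_subset_outer_approx)
  show "(\<Inter>m. outer_approx k m) \<subseteq> (R_sec_ge k :: 'n bivector_endo set)"
  proof
    fix R :: "'n bivector_endo" assume R: "R \<in> (\<Inter>m. outer_approx k m)"
    have ball: "curv_form k R z \<ge> 0" if "z \<in> ball 0 1" for z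
    proof (rule nonneg_if_ball_integral_squares_nonneg[where F = "curv_form k R", OF _ _ that])
      show "continuous_on UNIV (curv_form k R)"
        by (intro continuous_on_real_polynomial_function polynomial_curv_form)
      fix p :: "(real^'n) \<times> (real^'n) \<Rightarrow> real" assume "real_polynomial_function p"
      then obtain m where "fspan (monomials m) p" using polynomial_fspan_monomials_degree by blast
      then show "ball_integral (\<lambda>z. curv_form k R z * (p z)\<^sup>2) \<ge> 0"
        using R by (auto simp: outer_approx_def)
    qed
    have "curv_form k R z \<ge> 0" if "z \<in> stiefel" for z
    proof -
      \<comment> \<open>Nonnegativity is known inside the open ball, while \<open>stiefel\<close>
        lies on its boundary; homogeneity bridges the gap with the factor 1/16.\<close>
      have "(1 / 2) *\<^sub>R z \<in> ball 0 1" using that by (simp add: stiefel_def)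
      from ball[OF this] show ?thesis by (simp add: curv_form_scaleR zero_le_mult_iff)
    qed
    moreover have "R \<in> Sym2_b" using R by (auto simp: outer_approx_def)
    ultimately show "R \<in> R_sec_ge k" by (simp add: R_sec_ge_iff_stiefel)
  qed
qed

theorem theoremB:
  fixes k :: real
  assumes "CARD('n::finite) \<ge> 2"
  shows "\<exists>(I :: nat \<Rightarrow> 'n bivector_endo set) (J :: nat \<Rightarrow> 'n bivector_endo set).
    (\<forall>m. spectrahedral_shadow_in Sym2_b (I m) \<and> O_invariant (I m)) \<and>
    (\<forall>m. spectrahedron_in Sym2_b (J m) \<and> O_invariant (J m)) \<and>
    (\<forall>m. I m \<subseteq> I (Suc m)) \<and>
    (\<forall>m. I m \<subseteq> R_sec_ge k) \<and>
    (\<forall>m. R_sec_ge k \<subseteq> J m) \<and>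
    (\<forall>m. J (Suc m) \<subseteq> J m) \<and>
    closure (\<Union>m. I m) = R_sec_ge k \<and>
    (\<Inter>m. J m) = R_sec_ge k"
  by (intro exI[of _ "inner_approx k"] exI[of _ "outer_approx k"] conjI allI
      spectrahedral_shadow_inner_approx O_invariant_inner_approx spectrahedron_outer_approx
      O_invariant_outer_approx inner_approx_mono inner_approx_subset R_sec_ge_subset_outer_approx
      outer_approx_antimono closure_inner_approx Inter_outer_approx le_SucI order_refl)

end
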